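(* Let $\mathcal{P}=(P,\{\,,\,\})$, $P=P_0\ltimes P_1$, be an admissible Poisson algebra with corresponding Poisson triple $([\,,\,]_1,\mathcal{D},\mathcal{K})$. Every 2-cocycle $\mathscr{C}\in\overline{\Gamma}^2_{P_0}$ of the cochain complex $(\overline{\Gamma}^*_{\mathcal{P}},\overline{\partial}_{\mathcal{D}})$ induces a $t$-parameterized family $\mathcal{P}^t=(P,\{\,,\,\}^t)$ of admissible Poisson algebras defined by $$\{f\oplus\eta,g\oplus\xi\}^t:=\{f\oplus\eta,g\oplus\xi\}+0\oplus(t\mathscr{C})(df,dg),\qquad t\in R,\ f\oplus\eta,g\oplus\xi\in P.$$ In particular, $\mathcal{P}=\mathcal{P}^{t=0}$. Moreover, there exists a $t$-parameterized family of $\mu$-gauge transformations inducing Poisson isomorphisms between the admissible Poisson algebras $\mathcal{P}^t$ and $\mathcal{P}$ (for all $t\in R$) if and only if the $\overline{\partial}_{\mathcal{D}}$-cohomology class of $\mathscr{C}$ is trivial.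
   Context: Let $R$ be a commutative ring with unit, $\mathcal{P}_0=(P_0,\cdot,\{\,,\,\}_0)$ a Poisson $R$-algebra (commutative associative unital $R$-algebra with an $R$-bilinear Lie bracket that is a derivation in each argument), $P_1$ a faithful $P_0$-module, and $P=P_0\ltimes P_1$ the $R$-module $P_0\oplus P_1$ with product $(f\oplus\eta)(g\oplus\xi)=fg\oplus(f\xi+g\eta)$. An admissible Poisson structure on $P$ is a Poisson structure with $\mathrm{pr}_0\{f\oplus\eta,g\oplus\xi\}=\{f,g\}_0$; $(P,\{\,,\,\})$ is then an admissible Poisson algebra. $\Omega^1_{P_0}$ is the module of Kähler differentials of $P_0$ over $R$ with universal derivation $d$; $\varrho_{P_0}:\Omega^1_{P_0}\to\mathrm{Der}(P_0)$ is the $P_0$-linear map with $\varrho_{P_0}(dh)=\{h,\cdot\}_0$; $[\![\,,\,]\!]_{P_0}$ is the Lie bracket on $\Omega^1_{P_0}$ with $[\![df,dg]\!]_{P_0}=d\{f,g\}_0$ and $[\![\alpha,f\beta]\!]_{P_0}=f[\![\alpha,\beta]\!]_{P_0}+\varrho_{P_0}(\alpha)(f)\beta$. A contravariant derivative on $P_1$ is an $R$-bilinear map $\mathcal{D}:\Omega^1_{P_0}\times P_1\to P_1$ with $\mathcal{D}_{f\alpha}\eta=f\mathcal{D}_\alpha\eta$, $\mathcal{D}_\alpha(f\eta)=f\mathcal{D}_\alpha\eta+\varrho_{P_0}(\alpha)(f)\eta$. Every admissible Poisson algebra has a unique corresponding Poisson triple $([\,,\,]_1,\mathcal{D},\mathcal{K})$,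 where $[\,,\,]_1$ is a $P_0$-linear Lie bracket on $P_1$, $\mathcal{D}$ a contravariant derivative on $P_1$, and $\mathcal{K}:\Omega^1_{P_0}\times\Omega^1_{P_0}\to P_1$ a $P_0$-bilinear skew-symmetric map, such that $\{f\oplus\eta,g\oplus\xi\}=\{f,g\}_0\oplus(\mathcal{D}_{df}\xi-\mathcal{D}_{dg}\eta+[\eta,\xi]_1+\mathcal{K}(df,dg))$. Let $Z_{\mathcal{P}}(P_1)=\{\xi\in P_1\mid[\xi,\cdot]_1=0\}$. $\overline{\Gamma}^k_{P_0}$ is the module of $P_0$-multilinear skew-symmetric maps $(\Omega^1_{P_0})^k\to Z_{\mathcal{P}}(P_1)$ ($\overline{\Gamma}^0_{P_0}=Z_{\mathcal{P}}(P_1)$), $\overline{\Gamma}^*_{\mathcal{P}}=\oplus_k\overline{\Gamma}^k_{P_0}$, with coboundary operator $(\overline{\partial}_{\mathcal{D}}Q)(\alpha_0,\dots,\alpha_k)=\sum_i(-1)^i\mathcal{D}_{\alpha_i}(Q(\dots,\widehat{\alpha_i},\dots))+\sum_{i<j}(-1)^{i+j}Q([\![\alpha_i,\alpha_j]\!]_{P_0},\alpha_0,\dots,\widehat{\alpha_i},\dots,\widehat{\alpha_j},\dots,\alpha_k)$. For a $P_0$-linear map $\mu:\Omega^1_{P_0}\to P_1$, the $\mu$-gauge transformation is $\phi_\mu:P\to P$, $\phi_\mu(f\oplus\eta)=f\oplus(\mu(df)+\eta)$. A Poisson isomorphism is a bijective $R$-linear map preserving both products and brackets. *)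

theory Defs
  imports "HOL-Algebra.Module" "HOL-Algebra.AbelCoset" "HOL-Library.FuncSet"
begin

section \<open>Linear and bilinear maps\<close>

definition linear_maps ::
  "('k, 'kx) ring_scheme \<Rightarrow> ('k, 'm, 'mx) module_scheme \<Rightarrow> ('k, 'n, 'nx) module_scheme \<Rightarrow> ('m \<Rightarrow> 'n) set"
  where "linear_maps K M N = {f \<in> carrier M \<rightarrow> carrier N.
     (\<forall>x\<in>carrier M. \<forall>y\<in>carrier M. f (x \<oplus>\<^bsub>M\<^esub> y) = f x \<oplus>\<^bsub>N\<^esub> f y) \<and>
     (\<forall>a\<in>carrier K. \<forall>x\<in>carrier M. f (a \<odot>\<^bsub>M\<^esub> x) = a \<odot>\<^bsub>N\<^esub> f x)}"

definition bilinear_maps ::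
  "('k, 'kx) ring_scheme \<Rightarrow> ('k, 'l, 'lx) module_scheme \<Rightarrow> ('k, 'm, 'mx) module_scheme \<Rightarrow>
   ('k, 'n, 'nx) module_scheme \<Rightarrow> ('l \<Rightarrow> 'm \<Rightarrow> 'n) set"
  where "bilinear_maps K L M N = {b.
     (\<forall>x\<in>carrier L. b x \<in> linear_maps K M N) \<and>
     (\<forall>y\<in>carrier M. (\<lambda>x. b x y) \<in> linear_maps K L N)}"

definition skew_symmetric_on ::
  "'l set \<Rightarrow> ('k, 'n, 'nx) module_scheme \<Rightarrow> ('l \<Rightarrow> 'l \<Rightarrow> 'n) \<Rightarrow> bool"
  where "skew_symmetric_on S N b \<longleftrightarrow> (\<forall>x\<in>S. \<forall>y\<in>S. b x y = \<ominus>\<^bsub>N\<^esub> b y x)"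

definition faithful_module :: "('k, 'kx) ring_scheme \<Rightarrow> ('k, 'm, 'mx) module_scheme \<Rightarrow> bool"
  where "faithful_module K M \<longleftrightarrow> module K M \<and>
     (\<forall>a\<in>carrier K. (\<forall>x\<in>carrier M. a \<odot>\<^bsub>M\<^esub> x = \<zero>\<^bsub>M\<^esub>) \<longrightarrow> a = \<zero>\<^bsub>K\<^esub>)"

text \<open>A module over an \<open>R\<close>-algebra \<open>A\<close>, regarded as an \<open>R\<close>-module.\<close>

definition restrict_scalars ::
  "('r, 'a, 'ax) module_scheme \<Rightarrow> ('a, 'm, 'mx) module_scheme \<Rightarrow> ('r, 'm) module"
  where "restrict_scalars A M =
    \<lparr>carrier = carrier M, mult = mult M, one = one M, zero = zero M, add = add M,
     smult = (\<lambda>r x. (r \<odot>\<^bsub>A\<^esub> \<one>\<^bsub>A\<^esub>) \<odot>\<^bsub>M\<^esub> x)\<rparr>"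

section \<open>Lie brackets and Poisson algebras\<close>

text \<open>Over a ring in which 2 need not be invertible, skew-symmetric always means
  \<open>b x y = - b y x\<close>, both for Lie brackets and for cochains.\<close>

definition lie_bracket ::
  "('k, 'kx) ring_scheme \<Rightarrow> ('k, 'm, 'mx) module_scheme \<Rightarrow> ('m \<Rightarrow> 'm \<Rightarrow> 'm) \<Rightarrow> bool"
  where "lie_bracket K M b \<longleftrightarrow>
     b \<in> bilinear_maps K M M M \<and> skew_symmetric_on (carrier M) M b \<and>
     (\<forall>x\<in>carrier M. \<forall>y\<in>carrier M. \<forall>z\<in>carrier M.
        b x (b y z) \<oplus>\<^bsub>M\<^esub> b y (b z x) \<oplus>\<^bsub>M\<^esub> b z (b x y) = \<zero>\<^bsub>M\<^esub>)"

definition derivations ::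
  "('r, 'rx) ring_scheme \<Rightarrow> ('r, 'a, 'ax) module_scheme \<Rightarrow> ('a \<Rightarrow> 'a) set"
  where "derivations R A = {\<delta> \<in> linear_maps R A A.
     \<forall>f\<in>carrier A. \<forall>g\<in>carrier A. \<delta> (f \<otimes>\<^bsub>A\<^esub> g) = \<delta> f \<otimes>\<^bsub>A\<^esub> g \<oplus>\<^bsub>A\<^esub> f \<otimes>\<^bsub>A\<^esub> \<delta> g}"

definition poisson_algebra ::
  "('r, 'rx) ring_scheme \<Rightarrow> ('r, 'a, 'ax) module_scheme \<Rightarrow> ('a \<Rightarrow> 'a \<Rightarrow> 'a) \<Rightarrow> bool"
  where "poisson_algebra R A br \<longleftrightarrow>
     algebra R A \<and> lie_bracket R A br \<and>
     (\<forall>f\<in>carrier A. br f \<in> derivations R A \<and> (\<lambda>g. br g f) \<in> derivations R A)"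

definition poisson_iso ::
  "('r, 'rx) ring_scheme \<Rightarrow> ('r, 'a, 'ax) module_scheme \<Rightarrow> ('a \<Rightarrow> 'a \<Rightarrow> 'a) \<Rightarrow>
   ('r, 'b, 'bx) module_scheme \<Rightarrow> ('b \<Rightarrow> 'b \<Rightarrow> 'b) \<Rightarrow> ('a \<Rightarrow> 'b) \<Rightarrow> bool"
  where "poisson_iso R A brA B brB \<phi> \<longleftrightarrow>
     bij_betw \<phi> (carrier A) (carrier B) \<and> \<phi> \<in> linear_maps R A B \<and>
     (\<forall>x\<in>carrier A. \<forall>y\<in>carrier A. \<phi> (x \<otimes>\<^bsub>A\<^esub> y) = \<phi> x \<otimes>\<^bsub>B\<^esub> \<phi> y) \<and>
     (\<forall>x\<in>carrier A. \<forall>y\<in>carrier A. \<phi> (brA x y) = brB (\<phi> x) (\<phi> y))"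

section \<open>The algebra \<open>P = P\<^sub>0 \<ltimes> P\<^sub>1\<close>\<close>

definition semidirect ::
  "('r, 'a, 'ax) module_scheme \<Rightarrow> ('a, 'm, 'mx) module_scheme \<Rightarrow> ('r, 'a \<times> 'm) module"
  where "semidirect P\<^sub>0 P\<^sub>1 =
    \<lparr>carrier = carrier P\<^sub>0 \<times> carrier P\<^sub>1,
     mult = (\<lambda>(f, \<eta>) (g, \<xi>). (f \<otimes>\<^bsub>P\<^sub>0\<^esub> g, f \<odot>\<^bsub>P\<^sub>1\<^esub> \<xi> \<oplus>\<^bsub>P\<^sub>1\<^esub> g \<odot>\<^bsub>P\<^sub>1\<^esub> \<eta>)),
     one = (\<one>\<^bsub>P\<^sub>0\<^esub>, \<zero>\<^bsub>P\<^sub>1\<^esub>),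
     zero = (\<zero>\<^bsub>P\<^sub>0\<^esub>, \<zero>\<^bsub>P\<^sub>1\<^esub>),
     add = (\<lambda>(f, \<eta>) (g, \<xi>). (f \<oplus>\<^bsub>P\<^sub>0\<^esub> g, \<eta> \<oplus>\<^bsub>P\<^sub>1\<^esub> \<xi>)),
     smult = (\<lambda>r (f, \<eta>). (r \<odot>\<^bsub>P\<^sub>0\<^esub> f, r \<odot>\<^bsub>restrict_scalars P\<^sub>0 P\<^sub>1\<^esub> \<eta>))\<rparr>"

definition admissible_poisson ::
  "('r, 'rx) ring_scheme \<Rightarrow> ('r, 'a, 'ax) module_scheme \<Rightarrow> ('a \<Rightarrow> 'a \<Rightarrow> 'a) \<Rightarrow>
   ('a, 'm, 'mx) module_scheme \<Rightarrow> ('a \<times> 'm \<Rightarrow> 'a \<times> 'm \<Rightarrow> 'a \<times> 'm) \<Rightarrow> bool"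
  where "admissible_poisson R P\<^sub>0 br\<^sub>0 P\<^sub>1 br \<longleftrightarrow>
     poisson_algebra R (semidirect P\<^sub>0 P\<^sub>1) br \<and>
     (\<forall>x\<in>carrier (semidirect P\<^sub>0 P\<^sub>1). \<forall>y\<in>carrier (semidirect P\<^sub>0 P\<^sub>1).
        fst (br x y) = br\<^sub>0 (fst x) (fst y))"

section \<open>Kaehler differentials\<close>

text \<open>The free \<open>A\<close>-module on symbols indexed by the elements of \<open>A\<close>: finitely supported
  coefficient functions. A module record also carries ring multiplication fields, which play no
  role for modules and are left \<open>undefined\<close>.\<close>

definition free_module_on :: "('r, 'a, 'ax) module_scheme \<Rightarrow> ('a, 'a \<Rightarrow> 'a) module"
  where "free_module_on A =
    \<lparr>carrier = {\<phi>. (\<forall>h. \<phi> h \<in> carrier A) \<and> (\<forall>h. h \<notin> carrier A \<longrightarrow> \<phi> h = \<zero>\<^bsub>A\<^esub>) \<and>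
                   finite {h. \<phi> h \<noteq> \<zero>\<^bsub>A\<^esub>}},
     mult = undefined, one = undefined,
     zero = (\<lambda>_. \<zero>\<^bsub>A\<^esub>),
     add = (\<lambda>\<phi> \<psi> h. \<phi> h \<oplus>\<^bsub>A\<^esub> \<psi> h),
     smult = (\<lambda>a \<phi> h. a \<otimes>\<^bsub>A\<^esub> \<phi> h)\<rparr>"

definition free_generator :: "('r, 'a, 'ax) module_scheme \<Rightarrow> 'a \<Rightarrow> 'a \<Rightarrow> 'a"
  where "free_generator A f = (\<lambda>h. if h = f then \<one>\<^bsub>A\<^esub> else \<zero>\<^bsub>A\<^esub>)"

definition submodule_span ::
  "('k, 'kx) ring_scheme \<Rightarrow> ('k, 'm, 'mx) module_scheme \<Rightarrow> 'm set \<Rightarrow> 'm set"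
  where "submodule_span K M S = \<Inter>{H. submodule H K M \<and> S \<subseteq> H}"

definition quotient_module :: "('k, 'm, 'mx) module_scheme \<Rightarrow> 'm set \<Rightarrow> ('k, 'm set) module"
  where "quotient_module M N =
    \<lparr>carrier = a_rcosets\<^bsub>M\<^esub> N,
     mult = undefined, one = undefined,
     zero = N,
     add = set_add M,
     smult = (\<lambda>a X. \<Union>x\<in>X. N +>\<^bsub>M\<^esub> (a \<odot>\<^bsub>M\<^esub> x))\<rparr>"

definition kahler_relations ::
  "('r, 'rx) ring_scheme \<Rightarrow> ('r, 'a, 'ax) module_scheme \<Rightarrow> ('a \<Rightarrow> 'a) set"
  where "kahler_relations R A = (let F = free_module_on A; e = free_generator A in
     {e (f \<oplus>\<^bsub>A\<^esub> g) \<ominus>\<^bsub>F\<^esub> (e f \<oplus>\<^bsub>F\<^esub> e g) | f g. f \<in> carrier A \<and> g \<in> carrier A} \<union>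
     {e (r \<odot>\<^bsub>A\<^esub> f) \<ominus>\<^bsub>F\<^esub> (r \<odot>\<^bsub>restrict_scalars A F\<^esub> e f) | r f. r \<in> carrier R \<and> f \<in> carrier A} \<union>
     {e (f \<otimes>\<^bsub>A\<^esub> g) \<ominus>\<^bsub>F\<^esub> (f \<odot>\<^bsub>F\<^esub> e g \<oplus>\<^bsub>F\<^esub> g \<odot>\<^bsub>F\<^esub> e f) | f g. f \<in> carrier A \<and> g \<in> carrier A})"

definition kahler_submodule ::
  "('r, 'rx) ring_scheme \<Rightarrow> ('r, 'a, 'ax) module_scheme \<Rightarrow> ('a \<Rightarrow> 'a) set"
  where "kahler_submodule R A = submodule_span A (free_module_on A) (kahler_relations R A)"

definition kahler ::
  "('r, 'rx) ring_scheme \<Rightarrow> ('r, 'a, 'ax) module_scheme \<Rightarrow> ('a, ('a \<Rightarrow> 'a) set) module"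
  where "kahler R A = quotient_module (free_module_on A) (kahler_submodule R A)"

definition kahler_d ::
  "('r, 'rx) ring_scheme \<Rightarrow> ('r, 'a, 'ax) module_scheme \<Rightarrow> 'a \<Rightarrow> ('a \<Rightarrow> 'a) set"
  where "kahler_d R A f = kahler_submodule R A +>\<^bsub>free_module_on A\<^esub> free_generator A f"

text \<open>Since the differentials \<open>d f\<close> generate, the following two predicates determine \<open>\<rho>\<close> and
  \<open>lb\<close> uniquely on \<open>\<Omega>\<^sup>1\<close>.\<close>

definition poisson_anchor ::
  "('r, 'rx) ring_scheme \<Rightarrow> ('r, 'a, 'ax) module_scheme \<Rightarrow> ('a \<Rightarrow> 'a \<Rightarrow> 'a) \<Rightarrow>
   (('a \<Rightarrow> 'a) set \<Rightarrow> 'a \<Rightarrow> 'a) \<Rightarrow> bool"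
  where "poisson_anchor R P\<^sub>0 br\<^sub>0 \<rho> \<longleftrightarrow> (let \<Omega> = kahler R P\<^sub>0; d = kahler_d R P\<^sub>0 in
     \<rho> \<in> carrier \<Omega> \<rightarrow> derivations R P\<^sub>0 \<and>
     (\<forall>\<alpha>\<in>carrier \<Omega>. \<forall>\<beta>\<in>carrier \<Omega>. \<forall>f\<in>carrier P\<^sub>0.
        \<rho> (\<alpha> \<oplus>\<^bsub>\<Omega>\<^esub> \<beta>) f = \<rho> \<alpha> f \<oplus>\<^bsub>P\<^sub>0\<^esub> \<rho> \<beta> f) \<and>
     (\<forall>a\<in>carrier P\<^sub>0. \<forall>\<alpha>\<in>carrier \<Omega>. \<forall>f\<in>carrier P\<^sub>0.
        \<rho> (a \<odot>\<^bsub>\<Omega>\<^esub> \<alpha>) f = a \<otimes>\<^bsub>P\<^sub>0\<^esub> \<rho> \<alpha> f) \<and>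
     (\<forall>h\<in>carrier P\<^sub>0. \<forall>f\<in>carrier P\<^sub>0. \<rho> (d h) f = br\<^sub>0 h f))"

definition kahler_lie_bracket ::
  "('r, 'rx) ring_scheme \<Rightarrow> ('r, 'a, 'ax) module_scheme \<Rightarrow> ('a \<Rightarrow> 'a \<Rightarrow> 'a) \<Rightarrow>
   (('a \<Rightarrow> 'a) set \<Rightarrow> 'a \<Rightarrow> 'a) \<Rightarrow> (('a \<Rightarrow> 'a) set \<Rightarrow> ('a \<Rightarrow> 'a) set \<Rightarrow> ('a \<Rightarrow> 'a) set) \<Rightarrow> bool"
  where "kahler_lie_bracket R P\<^sub>0 br\<^sub>0 \<rho> lb \<longleftrightarrow> (let \<Omega> = kahler R P\<^sub>0; d = kahler_d R P\<^sub>0 in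
     lie_bracket R (restrict_scalars P\<^sub>0 \<Omega>) lb \<and>
     (\<forall>f\<in>carrier P\<^sub>0. \<forall>g\<in>carrier P\<^sub>0. lb (d f) (d g) = d (br\<^sub>0 f g)) \<and>
     (\<forall>\<alpha>\<in>carrier \<Omega>. \<forall>\<beta>\<in>carrier \<Omega>. \<forall>f\<in>carrier P\<^sub>0.
        lb \<alpha> (f \<odot>\<^bsub>\<Omega>\<^esub> \<beta>) = f \<odot>\<^bsub>\<Omega>\<^esub> lb \<alpha> \<beta> \<oplus>\<^bsub>\<Omega>\<^esub> \<rho> \<alpha> f \<odot>\<^bsub>\<Omega>\<^esub> \<beta>))"

section \<open>Poisson triples\<close>

definition contravariant_derivative ::
  "('r, 'rx) ring_scheme \<Rightarrow> ('r, 'a, 'ax) module_scheme \<Rightarrow> (('a \<Rightarrow> 'a) set \<Rightarrow> 'a \<Rightarrow> 'a) \<Rightarrow>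
   ('a, 'm, 'mx) module_scheme \<Rightarrow> (('a \<Rightarrow> 'a) set \<Rightarrow> 'm \<Rightarrow> 'm) \<Rightarrow> bool"
  where "contravariant_derivative R P\<^sub>0 \<rho> P\<^sub>1 D \<longleftrightarrow> (let \<Omega> = kahler R P\<^sub>0 in
     D \<in> bilinear_maps R (restrict_scalars P\<^sub>0 \<Omega>) (restrict_scalars P\<^sub>0 P\<^sub>1) (restrict_scalars P\<^sub>0 P\<^sub>1) \<and>
     (\<forall>\<alpha>\<in>carrier \<Omega>. \<forall>\<eta>\<in>carrier P\<^sub>1. \<forall>f\<in>carrier P\<^sub>0.
        D (f \<odot>\<^bsub>\<Omega>\<^esub> \<alpha>) \<eta> = f \<odot>\<^bsub>P\<^sub>1\<^esub> D \<alpha> \<eta> \<and>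
        D \<alpha> (f \<odot>\<^bsub>P\<^sub>1\<^esub> \<eta>) = f \<odot>\<^bsub>P\<^sub>1\<^esub> D \<alpha> \<eta> \<oplus>\<^bsub>P\<^sub>1\<^esub> \<rho> \<alpha> f \<odot>\<^bsub>P\<^sub>1\<^esub> \<eta>))"

definition corresponding_triple ::
  "('r, 'rx) ring_scheme \<Rightarrow> ('r, 'a, 'ax) module_scheme \<Rightarrow> ('a \<Rightarrow> 'a \<Rightarrow> 'a) \<Rightarrow>
   (('a \<Rightarrow> 'a) set \<Rightarrow> 'a \<Rightarrow> 'a) \<Rightarrow> ('a, 'm, 'mx) module_scheme \<Rightarrow>
   ('a \<times> 'm \<Rightarrow> 'a \<times> 'm \<Rightarrow> 'a \<times> 'm) \<Rightarrow> ('m \<Rightarrow> 'm \<Rightarrow> 'm) \<Rightarrow>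
   (('a \<Rightarrow> 'a) set \<Rightarrow> 'm \<Rightarrow> 'm) \<Rightarrow> (('a \<Rightarrow> 'a) set \<Rightarrow> ('a \<Rightarrow> 'a) set \<Rightarrow> 'm) \<Rightarrow> bool"
  where "corresponding_triple R P\<^sub>0 br\<^sub>0 \<rho> P\<^sub>1 br br\<^sub>1 D \<K> \<longleftrightarrow>
     (let \<Omega> = kahler R P\<^sub>0; d = kahler_d R P\<^sub>0 in
     lie_bracket P\<^sub>0 P\<^sub>1 br\<^sub>1 \<and>
     contravariant_derivative R P\<^sub>0 \<rho> P\<^sub>1 D \<and>
     \<K> \<in> bilinear_maps P\<^sub>0 \<Omega> \<Omega> P\<^sub>1 \<and> skew_symmetric_on (carrier \<Omega>) P\<^sub>1 \<K> \<and>
     (\<forall>f\<in>carrier P\<^sub>0. \<forall>\<eta>\<in>carrier P\<^sub>1. \<forall>g\<in>carrier P\<^sub>0. \<forall>\<xi>\<in>carrier P\<^sub>1.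
        br (f, \<eta>) (g, \<xi>) =
          (br\<^sub>0 f g, D (d f) \<xi> \<ominus>\<^bsub>P\<^sub>1\<^esub> D (d g) \<eta> \<oplus>\<^bsub>P\<^sub>1\<^esub> br\<^sub>1 \<eta> \<xi> \<oplus>\<^bsub>P\<^sub>1\<^esub> \<K> (d f) (d g))))"

section \<open>The cochain complex\<close>

definition bracket_center ::
  "('a, 'm, 'mx) module_scheme \<Rightarrow> ('m \<Rightarrow> 'm \<Rightarrow> 'm) \<Rightarrow> 'm set"
  where "bracket_center P\<^sub>1 br\<^sub>1 = {\<xi> \<in> carrier P\<^sub>1. \<forall>\<eta>\<in>carrier P\<^sub>1. br\<^sub>1 \<xi> \<eta> = \<zero>\<^bsub>P\<^sub>1\<^esub>}"

text \<open>A \<open>k\<close>-cochain is a function on lists of length \<open>k\<close>, extensional so that equality of cochains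
  is equality of functions. For \<open>k = 0\<close> only the empty list remains and a cochain is an element of
  the center. The complex is defined for an arbitrary \<open>P\<^sub>0\<close>-module \<open>\<Omega>\<close>.\<close>

definition tuples :: "('a, 'w, 'wx) module_scheme \<Rightarrow> nat \<Rightarrow> 'w list set"
  where "tuples \<Omega> k = {xs. length xs = k \<and> set xs \<subseteq> carrier \<Omega>}"

definition cochains ::
  "('r, 'a, 'ax) module_scheme \<Rightarrow> ('a, 'w, 'wx) module_scheme \<Rightarrow> ('a, 'm, 'mx) module_scheme \<Rightarrow>
   ('m \<Rightarrow> 'm \<Rightarrow> 'm) \<Rightarrow> nat \<Rightarrow> ('w list \<Rightarrow> 'm) set"
  where "cochains P\<^sub>0 \<Omega> P\<^sub>1 br\<^sub>1 k = {Q \<in> tuples \<Omega> k \<rightarrow>\<^sub>E bracket_center P\<^sub>1 br\<^sub>1.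
     \<forall>xs\<in>tuples \<Omega> k.
       (\<forall>i<k. (\<lambda>\<alpha>. Q (xs[i := \<alpha>])) \<in> linear_maps P\<^sub>0 \<Omega> P\<^sub>1) \<and>
       (\<forall>j<k. \<forall>i<j. Q (xs[i := xs ! j, j := xs ! i]) = \<ominus>\<^bsub>P\<^sub>1\<^esub> Q xs)}"

definition cochain_module ::
  "('r, 'a, 'ax) module_scheme \<Rightarrow> ('a, 'w, 'wx) module_scheme \<Rightarrow> ('a, 'm, 'mx) module_scheme \<Rightarrow>
   ('m \<Rightarrow> 'm \<Rightarrow> 'm) \<Rightarrow> nat \<Rightarrow> ('a, 'w list \<Rightarrow> 'm) module"
  where "cochain_module P\<^sub>0 \<Omega> P\<^sub>1 br\<^sub>1 k =
    \<lparr>carrier = cochains P\<^sub>0 \<Omega> P\<^sub>1 br\<^sub>1 k,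
     mult = undefined, one = undefined,
     zero = (\<lambda>xs\<in>tuples \<Omega> k. \<zero>\<^bsub>P\<^sub>1\<^esub>),
     add = (\<lambda>Q Q'. \<lambda>xs\<in>tuples \<Omega> k. Q xs \<oplus>\<^bsub>P\<^sub>1\<^esub> Q' xs),
     smult = (\<lambda>a Q. \<lambda>xs\<in>tuples \<Omega> k. a \<odot>\<^bsub>P\<^sub>1\<^esub> Q xs)\<rparr>"

definition alt_sign :: "('a, 'm, 'mx) module_scheme \<Rightarrow> nat \<Rightarrow> 'm \<Rightarrow> 'm"
  where "alt_sign M i x = (if even i then x else \<ominus>\<^bsub>M\<^esub> x)"

text \<open>\<open>nths xs (- I)\<close> is the list \<open>xs\<close> with the entries at positions in \<open>I\<close> omitted.\<close>

definition coboundary ::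
  "('a, 'w, 'wx) module_scheme \<Rightarrow> ('w \<Rightarrow> 'w \<Rightarrow> 'w) \<Rightarrow> ('a, 'm, 'mx) module_scheme \<Rightarrow>
   ('w \<Rightarrow> 'm \<Rightarrow> 'm) \<Rightarrow> nat \<Rightarrow> ('w list \<Rightarrow> 'm) \<Rightarrow> 'w list \<Rightarrow> 'm"
  where "coboundary \<Omega> lb P\<^sub>1 D k Q = (\<lambda>xs\<in>tuples \<Omega> (Suc k).
     (\<Oplus>\<^bsub>P\<^sub>1\<^esub> i \<in> {..k}. alt_sign P\<^sub>1 i (D (xs ! i) (Q (nths xs (- {i}))))) \<oplus>\<^bsub>P\<^sub>1\<^esub>
     (\<Oplus>\<^bsub>P\<^sub>1\<^esub> p \<in> {(i, j). i < j \<and> j \<le> k}. case p of (i, j) \<Rightarrow>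
        alt_sign P\<^sub>1 (i + j) (Q (lb (xs ! i) (xs ! j) # nths xs (- {i, j})))))"

definition cocycles ::
  "('r, 'a, 'ax) module_scheme \<Rightarrow> ('a, 'w, 'wx) module_scheme \<Rightarrow> ('w \<Rightarrow> 'w \<Rightarrow> 'w) \<Rightarrow>
   ('a, 'm, 'mx) module_scheme \<Rightarrow> ('m \<Rightarrow> 'm \<Rightarrow> 'm) \<Rightarrow> ('w \<Rightarrow> 'm \<Rightarrow> 'm) \<Rightarrow> nat \<Rightarrow> ('w list \<Rightarrow> 'm) set"
  where "cocycles P\<^sub>0 \<Omega> lb P\<^sub>1 br\<^sub>1 D k =
    {Q \<in> cochains P\<^sub>0 \<Omega> P\<^sub>1 br\<^sub>1 k.
       coboundary \<Omega> lb P\<^sub>1 D k Q = \<zero>\<^bsub>cochain_module P\<^sub>0 \<Omega> P\<^sub>1 br\<^sub>1 (Suc k)\<^esub>}"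

definition coboundaries ::
  "('r, 'a, 'ax) module_scheme \<Rightarrow> ('a, 'w, 'wx) module_scheme \<Rightarrow> ('w \<Rightarrow> 'w \<Rightarrow> 'w) \<Rightarrow>
   ('a, 'm, 'mx) module_scheme \<Rightarrow> ('m \<Rightarrow> 'm \<Rightarrow> 'm) \<Rightarrow> ('w \<Rightarrow> 'm \<Rightarrow> 'm) \<Rightarrow> nat \<Rightarrow> ('w list \<Rightarrow> 'm) set"
  where "coboundaries P\<^sub>0 \<Omega> lb P\<^sub>1 br\<^sub>1 D k = (case k of
       0 \<Rightarrow> {\<zero>\<^bsub>cochain_module P\<^sub>0 \<Omega> P\<^sub>1 br\<^sub>1 0\<^esub>}
     | Suc j \<Rightarrow> coboundary \<Omega> lb P\<^sub>1 D j ` cochains P\<^sub>0 \<Omega> P\<^sub>1 br\<^sub>1 j)"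

definition cohomology_class ::
  "('r, 'a, 'ax) module_scheme \<Rightarrow> ('a, 'w, 'wx) module_scheme \<Rightarrow> ('w \<Rightarrow> 'w \<Rightarrow> 'w) \<Rightarrow>
   ('a, 'm, 'mx) module_scheme \<Rightarrow> ('m \<Rightarrow> 'm \<Rightarrow> 'm) \<Rightarrow> ('w \<Rightarrow> 'm \<Rightarrow> 'm) \<Rightarrow> nat \<Rightarrow>
   ('w list \<Rightarrow> 'm) \<Rightarrow> ('w list \<Rightarrow> 'm) set"
  where "cohomology_class P\<^sub>0 \<Omega> lb P\<^sub>1 br\<^sub>1 D k Q =
     coboundaries P\<^sub>0 \<Omega> lb P\<^sub>1 br\<^sub>1 D k +>\<^bsub>cochain_module P\<^sub>0 \<Omega> P\<^sub>1 br\<^sub>1 k\<^esub> Q"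

section \<open>Deformed brackets and gauge transformations\<close>

definition deformed_bracket ::
  "('r, 'rx) ring_scheme \<Rightarrow> ('r, 'a, 'ax) module_scheme \<Rightarrow> ('a, 'm, 'mx) module_scheme \<Rightarrow>
   ('m \<Rightarrow> 'm \<Rightarrow> 'm) \<Rightarrow> ('a \<times> 'm \<Rightarrow> 'a \<times> 'm \<Rightarrow> 'a \<times> 'm) \<Rightarrow> (('a \<Rightarrow> 'a) set list \<Rightarrow> 'm) \<Rightarrow> 'r \<Rightarrow>
   'a \<times> 'm \<Rightarrow> 'a \<times> 'm \<Rightarrow> 'a \<times> 'm"
  where "deformed_bracket R P\<^sub>0 P\<^sub>1 br\<^sub>1 br C t = (\<lambda>(f, \<eta>) (g, \<xi>).
     let d = kahler_d R P\<^sub>0;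
         tC = t \<odot>\<^bsub>restrict_scalars P\<^sub>0 (cochain_module P\<^sub>0 (kahler R P\<^sub>0) P\<^sub>1 br\<^sub>1 2)\<^esub> C
     in br (f, \<eta>) (g, \<xi>) \<oplus>\<^bsub>semidirect P\<^sub>0 P\<^sub>1\<^esub> (\<zero>\<^bsub>P\<^sub>0\<^esub>, tC [d f, d g]))"

definition gauge ::
  "('r, 'rx) ring_scheme \<Rightarrow> ('r, 'a, 'ax) module_scheme \<Rightarrow> ('a, 'm, 'mx) module_scheme \<Rightarrow>
   (('a \<Rightarrow> 'a) set \<Rightarrow> 'm) \<Rightarrow> 'a \<times> 'm \<Rightarrow> 'a \<times> 'm"
  where "gauge R P\<^sub>0 P\<^sub>1 \<mu> = (\<lambda>(f, \<eta>). (f, \<mu> (kahler_d R P\<^sub>0 f) \<oplus>\<^bsub>P\<^sub>1\<^esub> \<eta>))"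

end

theory Submission
  imports Defs
begin

text \<open>Adding a central term \<open>c\<close> to the bracket changes its Jacobiator only by the cyclic sum of
  \<open>D\<^sub>\<alpha> (c \<beta> \<gamma>) + c \<alpha> (lb \<beta> \<gamma>)\<close>, because central elements drop out of \<open>br\<^sub>1\<close>; up to skew-symmetry
  this sum is the coboundary of \<open>c\<close>. A gauge transformation \<open>\<phi>\<^sub>\<mu>\<close> carries the perturbed bracket to
  the original one exactly when \<open>\<mu>\<close> is central (compare \<open>(f, 0)\<close> with \<open>(0, \<xi>)\<close>) and \<open>c\<close> is the
  coboundary of \<open>\<mu>\<close> on exact differentials; both sides are \<open>P\<^sub>0\<close>-bilinear and the \<open>d f\<close> generate, so
  this holds on all of \<open>\<Omega>\<close>. Hence \<open>t = 1\<close> yields a primitive of \<open>C\<close>, and a primitive \<open>\<mu>\<close> yields the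
  family \<open>t \<mu>\<close>.\<close>

section \<open>Linear maps and restriction of scalars\<close>

text \<open>Three points decide the form of the calculations. A perturbation \<open>c\<close> also
  contributes a quadratic term \<open>c x (c y z)\<close> to the Jacobiator; it vanishes because the
  inner value has first component zero, while \<open>c\<close> sees its arguments only through
  \<open>d\<close> of their first components. The coboundary of a \<open>P\<^sub>0\<close>-linear
  map is \<open>P\<^sub>0\<close>-bilinear although \<open>D\<close> and \<open>lb\<close> both obey
  Leibniz rules: their anchor terms cancel. The parameter is taken from \<open>R\<close> because
  \<open>D \<alpha>\<close> is only \<open>R\<close>-linear; this is what lets \<open>t\<close> pass
  through the coboundary, so that multiples of cocycles are cocycles and multiples of primitives are
  primitives.

  Cochains are extensional functions on lists, which is awkward for such identities. They are
  therefore proved for functions of one or two arguments in \<Omega>, and lists are translated only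
  in degrees 1 and 2. Likewise the quotient that defines \<Omega> is used later only through the
  rules for \<open>d\<close> and induction over multiples of exact differentials.\<close>

lemma linear_mapsI:
  assumes "\<And>x. x \<in> carrier M \<Longrightarrow> f x \<in> carrier N"
    and "\<And>x y. x \<in> carrier M \<Longrightarrow> y \<in> carrier M \<Longrightarrow> f (x \<oplus>\<^bsub>M\<^esub> y) = f x \<oplus>\<^bsub>N\<^esub> f y"
    and "\<And>a x. a \<in> carrier K \<Longrightarrow> x \<in> carrier M \<Longrightarrow> f (a \<odot>\<^bsub>M\<^esub> x) = a \<odot>\<^bsub>N\<^esub> f x"
  shows "f \<in> linear_maps K M N"
  using assms by (auto simp: linear_maps_def)

lemma linear_maps_closed: "f \<in> linear_maps K M N \<Longrightarrow> x \<in> carrier M \<Longrightarrow> f x \<in> carrier N"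
  by (auto simp: linear_maps_def)

lemma linear_maps_add:
  "f \<in> linear_maps K M N \<Longrightarrow> x \<in> carrier M \<Longrightarrow> y \<in> carrier M \<Longrightarrow> f (x \<oplus>\<^bsub>M\<^esub> y) = f x \<oplus>\<^bsub>N\<^esub> f y"
  by (auto simp: linear_maps_def)

lemma linear_maps_smult:
  "f \<in> linear_maps K M N \<Longrightarrow> a \<in> carrier K \<Longrightarrow> x \<in> carrier M \<Longrightarrow> f (a \<odot>\<^bsub>M\<^esub> x) = a \<odot>\<^bsub>N\<^esub> f x"
  by (auto simp: linear_maps_def)

lemma linear_maps_zero:
  assumes "f \<in> linear_maps K M N" "abelian_group M" "abelian_group N"
  shows "f \<zero>\<^bsub>M\<^esub> = \<zero>\<^bsub>N\<^esub>"
proof -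
  interpret M: abelian_group M by fact
  interpret N: abelian_group N by fact
  show ?thesis
    using linear_maps_add[OF assms(1), of "\<zero>\<^bsub>M\<^esub>" "\<zero>\<^bsub>M\<^esub>"] linear_maps_closed[OF assms(1), of "\<zero>\<^bsub>M\<^esub>"]
    by simp
qed

lemma linear_maps_uminus:
  assumes "f \<in> linear_maps K M N" "abelian_group M" "abelian_group N" "x \<in> carrier M"
  shows "f (\<ominus>\<^bsub>M\<^esub> x) = \<ominus>\<^bsub>N\<^esub> f x"
proof -
  interpret M: abelian_group M by fact
  interpret N: abelian_group N by fact
  have "f (\<ominus>\<^bsub>M\<^esub> x) \<oplus>\<^bsub>N\<^esub> f x = \<zero>\<^bsub>N\<^esub>"
    using linear_maps_add[OF assms(1), of "\<ominus>\<^bsub>M\<^esub> x" x] assms(4) linear_maps_zero[OF assms(1-3)] by (simp add: M.l_neg)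
  then show ?thesis
    using N.minus_equality linear_maps_closed[OF assms(1)] assms(4) by simp
qed

lemma restrict_scalars_simps [simp]:
  "carrier (restrict_scalars A M) = carrier M"
  "add (restrict_scalars A M) = add M"
  "zero (restrict_scalars A M) = zero M"
  "r \<odot>\<^bsub>restrict_scalars A M\<^esub> x = (r \<odot>\<^bsub>A\<^esub> \<one>\<^bsub>A\<^esub>) \<odot>\<^bsub>M\<^esub> x"
  by (simp_all add: restrict_scalars_def)

text \<open>Negation depends only on the carrier, zero and addition of the record, which restriction
  keeps. Skew-symmetry over the restricted module is thus skew-symmetry over
  \<open>M\<close>.\<close>

lemma a_inv_restrict_scalars [simp]: "a_inv (restrict_scalars A M) = a_inv M"
  by (auto simp: fun_eq_iff restrict_scalars_def a_inv_def m_inv_def)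

text \<open>The additive structure is all that \<open>linear_maps_zero\<close> and
  \<open>linear_maps_uminus\<close> ask for, so this suffices to apply them to the
  \<open>R\<close>-linear maps given by \<open>D\<close> and \<open>lb\<close>.\<close>

lemma abelian_group_restrict_scalars:
  assumes "abelian_group M" shows "abelian_group (restrict_scalars A M)"
proof -
  interpret abelian_group M by fact
  show ?thesis
  proof (rule abelian_groupI)
    fix x assume "x \<in> carrier (restrict_scalars A M)"
    then show "\<exists>y\<in>carrier (restrict_scalars A M). y \<oplus>\<^bsub>restrict_scalars A M\<^esub> x = \<zero>\<^bsub>restrict_scalars A M\<^esub>"
      by (intro bexI[of _ "\<ominus>\<^bsub>M\<^esub> x"]) (simp_all add: l_neg)
  qed (simp_all add: a_ac)
qed

section \<open>Free modules, quotient modules and Kaehler differentials\<close>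

lemma module_free_module_on:
  assumes "cring A" shows "module A (free_module_on A)"
proof -
  interpret cring A by fact
  let ?F = "free_module_on A"
  have fin: "finite {h. \<phi> h \<oplus>\<^bsub>A\<^esub> \<psi> h \<noteq> \<zero>\<^bsub>A\<^esub>}"
    if "finite {h. \<phi> h \<noteq> \<zero>\<^bsub>A\<^esub>}" "finite {h. \<psi> h \<noteq> \<zero>\<^bsub>A\<^esub>}" for \<phi> \<psi> :: "'a \<Rightarrow> 'a"
    by (rule finite_subset[OF _ finite_UnI[OF that]]) auto
  have fin2: "finite {h. a \<otimes>\<^bsub>A\<^esub> \<psi> h \<noteq> \<zero>\<^bsub>A\<^esub>}"
    if "finite {h. \<psi> h \<noteq> \<zero>\<^bsub>A\<^esub>}" "a \<in> carrier A" for \<psi> :: "'a \<Rightarrow> 'a" and a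
    by (rule finite_subset[OF _ that(1)]) (use that(2) in auto)
  have fin3: "finite {h. \<ominus>\<^bsub>A\<^esub> \<psi> h \<noteq> \<zero>\<^bsub>A\<^esub>}"
    if "finite {h. \<psi> h \<noteq> \<zero>\<^bsub>A\<^esub>}" for \<psi> :: "'a \<Rightarrow> 'a"
    by (rule finite_subset[OF _ that(1)]) auto
  show ?thesis
  proof (rule moduleI)
    show "abelian_group ?F"
    proof (rule abelian_groupI)
      fix x assume x: "x \<in> carrier ?F"
      show "\<exists>y\<in>carrier ?F. y \<oplus>\<^bsub>?F\<^esub> x = \<zero>\<^bsub>?F\<^esub>"
        using x fin3[of x] by (intro bexI[of _ "\<lambda>h. \<ominus>\<^bsub>A\<^esub> x h"]) (auto simp: free_module_on_def l_neg)
    qed (auto simp: free_module_on_def fun_eq_iff a_assoc intro!: fin a_comm)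
  qed (auto simp: free_module_on_def fun_eq_iff l_distr r_distr m_assoc fin2 assms)
qed

lemma free_generator_closed:
  assumes "cring A" "f \<in> carrier A" shows "free_generator A f \<in> carrier (free_module_on A)"
proof -
  interpret cring A by fact
  have "finite {h. free_generator A f h \<noteq> \<zero>\<^bsub>A\<^esub>}"
    by (rule finite_subset[of _ "{f}"]) (auto simp: free_generator_def)
  with assms(2) show ?thesis
    by (auto simp: free_module_on_def free_generator_def)
qed

text \<open>Induction over a finite set containing the support: the coefficient at one point is
  cleared and put back as a multiple of the generator at that point.\<close>

lemma free_module_on_induct:
  assumes "cring A" and \<phi>: "\<phi> \<in> carrier (free_module_on A)"
    and zero: "P \<zero>\<^bsub>free_module_on A\<^esub>"
    and add: "\<And>\<phi> \<psi>. \<phi> \<in> carrier (free_module_on A) \<Longrightarrow> \<psi> \<in> carrier (free_module_on A) \<Longrightarrow>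
      P \<phi> \<Longrightarrow> P \<psi> \<Longrightarrow> P (\<phi> \<oplus>\<^bsub>free_module_on A\<^esub> \<psi>)"
    and gen: "\<And>a f. a \<in> carrier A \<Longrightarrow> f \<in> carrier A \<Longrightarrow> P (a \<odot>\<^bsub>free_module_on A\<^esub> free_generator A f)"
  shows "P \<phi>"
proof -
  interpret cring A by fact
  interpret F: module A "free_module_on A" by (rule module_free_module_on) fact
  let ?F = "free_module_on A"
  have *: "P \<phi>" if "finite S" "\<phi> \<in> carrier ?F" "{h. \<phi> h \<noteq> \<zero>\<^bsub>A\<^esub>} \<subseteq> S" for S \<phi>
    using that
  proof (induction S arbitrary: \<phi> rule: finite_induct)
    case empty
    then have "\<phi> = \<zero>\<^bsub>?F\<^esub>" by (auto simp: free_module_on_def)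
    with zero show ?case by simp
  next
    case (insert s S)
    show ?case
    \<comment> \<open>There is no generator for a point outside the algebra, but the coefficient
      there is zero by definition and the induction hypothesis applies to \<phi> itself.\<close>
    proof (cases "s \<in> carrier A")
      case False
      with insert.prems have "\<phi> s = \<zero>\<^bsub>A\<^esub>" by (auto simp: free_module_on_def)
      then show ?thesis using insert.prems by (intro insert.IH) auto
    next
      case True
      let ?\<psi> = "\<phi>(s := \<zero>\<^bsub>A\<^esub>)"
      have "finite {h. ?\<psi> h \<noteq> \<zero>\<^bsub>A\<^esub>}"
        by (rule finite_subset[of _ S]) (use insert in auto)
      with insert.prems have \<psi>: "?\<psi> \<in> carrier ?F" by (auto simp: free_module_on_def)
      have P\<psi>: "P ?\<psi>" using insert.prems by (intro insert.IH \<psi>) auto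
      have s: "\<phi> s \<in> carrier A" using insert.prems by (auto simp: free_module_on_def)
      have "\<phi> h \<in> carrier A" for h using insert.prems by (auto simp: free_module_on_def)
      then have "\<phi> = ?\<psi> \<oplus>\<^bsub>?F\<^esub> (\<phi> s \<odot>\<^bsub>?F\<^esub> free_generator A s)"
        by (auto simp: free_module_on_def free_generator_def fun_eq_iff)
      then show ?thesis
        using add[OF \<psi> F.smult_closed[OF s free_generator_closed[OF assms(1) True]] P\<psi> gen[OF s True]]
        by simp
    qed
  qed
  show ?thesis
    by (rule *[of "{h. \<phi> h \<noteq> \<zero>\<^bsub>A\<^esub>}"]) (use \<phi> in \<open>auto simp: free_module_on_def\<close>)
qed

text \<open>Since \<open>S\<close> lies in the carrier, the whole module is one of the submodules
  intersected, and this keeps the intersection inside the carrier.\<close>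

lemma submodule_submodule_span:
  assumes "module K M" "S \<subseteq> carrier M"
  shows "submodule (submodule_span K M S) K M"
proof -
  interpret module K M by fact
  show ?thesis
  proof (rule submoduleI)
    show "submodule_span K M S \<subseteq> carrier M"
      using carrier_is_submodule assms(2) by (auto simp: submodule_span_def)
    show "\<zero>\<^bsub>M\<^esub> \<in> submodule_span K M S"
      using submodule.axioms(1) subgroup.one_closed by (force simp: submodule_span_def)
  qed (auto simp: submodule_span_def submoduleE)
qed

lemma submodule_span_superset: "S \<subseteq> submodule_span K M S"
  by (auto simp: submodule_span_def)

section \<open>Quotient modules computed on representatives\<close>

context
  fixes K :: "('k, 'kx) ring_scheme" and M :: "('k, 'm, 'mx) module_scheme" (structure) and N
  assumes mod: "module K M" and sub: "submodule N K M"
begin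

interpretation module K M by (rule mod)
interpretation N: submodule N K M by (rule sub)
interpretation N: abelian_subgroup N M
  by (rule abelian_subgroupI3)
    (simp_all add: additive_subgroup_def N.subgroup_axioms abelian_group_axioms M.abelian_group_axioms)

lemma coset_closed: "x \<in> carrier M \<Longrightarrow> N +> x \<in> carrier (quotient_module M N)"
  by (auto simp: quotient_module_def A_RCOSETS_def')

lemma quotient_module_carrierE:
  assumes "X \<in> carrier (quotient_module M N)"
  obtains x where "x \<in> carrier M" "X = N +> x"
  using assms by (auto simp: quotient_module_def A_RCOSETS_def')

lemma coset_add:
  "x \<in> carrier M \<Longrightarrow> y \<in> carrier M \<Longrightarrow>
    (N +> x) \<oplus>\<^bsub>quotient_module M N\<^esub> (N +> y) = N +> (x \<oplus> y)"
  by (simp add: quotient_module_def N.a_rcos_sum)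

lemma coset_eqI:
  assumes "x \<in> carrier M" "y \<in> carrier M" "x \<ominus> y \<in> N"
  shows "N +> x = N +> y"
proof -
  have "x \<in> N +> y"
    using assms by (intro N.a_rcos_module_rev) (simp_all add: a_minus_def)
  then show ?thesis
    using N.a_repr_independence' assms by blast
qed

text \<open>The scalar action on cosets is a union over all representatives. Two representatives
  differ by an element of \<open>N\<close>, and so do their multiples by \<open>a\<close>; the union
  is thus over a constant family, and a nonempty one because \<open>x\<close> lies in its own
  coset.\<close>

lemma coset_smult:
  assumes "a \<in> carrier K" "x \<in> carrier M"
  shows "a \<odot>\<^bsub>quotient_module M N\<^esub> (N +> x) = N +> (a \<odot> x)"
proof -
  have "N +> (a \<odot> y) = N +> (a \<odot> x)" if "y \<in> N +> x" for y
  proof (rule coset_eqI)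
    show y: "a \<odot> y \<in> carrier M" "a \<odot> x \<in> carrier M"
      using that assms N.a_elemrcos_carrier by blast+
    have "y \<ominus> x \<in> N"
      using that assms N.a_rcos_module_imp by (auto simp: a_minus_def)
    then have "a \<odot> (y \<ominus> x) \<in> N" using assms by simp
    then show "a \<odot> y \<ominus> a \<odot> x \<in> N"
      using assms N.a_elemrcos_carrier[OF assms(2) that] by (simp add: a_minus_def smult_r_distr smult_r_minus)
  qed
  then have "(\<Union>y\<in>N +> x. N +> (a \<odot> y)) = (\<Union>y\<in>N +> x. N +> (a \<odot> x))"
    by (intro SUP_cong refl)
  moreover have "N +> x \<noteq> {}" using N.a_rcos_self assms by blast
  ultimately show ?thesis by (simp add: quotient_module_def)
qed

text \<open>Writes the zero of the quotient, which is the set \<open>N\<close>, as a coset, so that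
  the module axioms can all be checked on representatives.\<close>

lemma coset_zero: "\<zero>\<^bsub>quotient_module M N\<^esub> = N +> \<zero>"
  using N.a_subset by (simp add: quotient_module_def)

lemma module_quotient_module: "module K (quotient_module M N)"
proof (rule moduleI)
  show "abelian_group (quotient_module M N)"
  proof (rule abelian_groupI)
    fix X assume "X \<in> carrier (quotient_module M N)"
    then obtain x where "x \<in> carrier M" "X = N +> x" by (rule quotient_module_carrierE)
    then show "\<exists>Y\<in>carrier (quotient_module M N). Y \<oplus>\<^bsub>quotient_module M N\<^esub> X = \<zero>\<^bsub>quotient_module M N\<^esub>"
      by (intro bexI[of _ "N +> (\<ominus> x)"]) (simp_all add: coset_add coset_closed coset_zero M.l_neg)
  next
    fix X Y assume "X \<in> carrier (quotient_module M N)" "Y \<in> carrier (quotient_module M N)"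
    then obtain x y where "x \<in> carrier M" "X = N +> x" "y \<in> carrier M" "Y = N +> y"
      by (metis quotient_module_carrierE)
    then show "X \<oplus>\<^bsub>quotient_module M N\<^esub> Y = Y \<oplus>\<^bsub>quotient_module M N\<^esub> X"
      by (simp add: coset_add M.a_comm)
  qed (auto elim!: quotient_module_carrierE simp: coset_add coset_closed coset_zero M.a_assoc)
qed (auto elim!: quotient_module_carrierE simp: coset_smult coset_add coset_closed
      smult_l_distr smult_r_distr smult_assoc1 R.is_cring)

end

section \<open>Kaehler differentials: rules for \<open>d\<close> and generation by exact
  differentials\<close>

context
  fixes R :: "('r, 'rx) ring_scheme" and A :: "('r, 'a, 'ax) module_scheme"
  assumes alg: "algebra R A"
begin

interpretation algebra R A by (rule alg)
interpretation F: module A "free_module_on A"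
  by (rule module_free_module_on) (rule M_cring)

lemma kahler_relations_subset: "kahler_relations R A \<subseteq> carrier (free_module_on A)"
  by (auto simp: kahler_relations_def Let_def free_generator_closed[OF M_cring])

lemma submodule_kahler_submodule: "submodule (kahler_submodule R A) A (free_module_on A)"
  unfolding kahler_submodule_def
  by (rule submodule_submodule_span) (rule F.module_axioms kahler_relations_subset)+

lemma module_kahler: "module A (kahler R A)"
  unfolding kahler_def
  by (rule module_quotient_module) (rule F.module_axioms submodule_kahler_submodule)+

lemma kahler_d_closed: "f \<in> carrier A \<Longrightarrow> kahler_d R A f \<in> carrier (kahler R A)"
  unfolding kahler_def kahler_d_def
  by (intro coset_closed[OF F.module_axioms submodule_kahler_submodule] free_generator_closed M_cring)

lemmas kahler_intros = coset_eqI[OF F.module_axioms submodule_kahler_submodule]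
lemmas kahler_simps = coset_add[OF F.module_axioms submodule_kahler_submodule]
  coset_smult[OF F.module_axioms submodule_kahler_submodule] free_generator_closed[OF M_cring]

lemma kahler_relations_mem: "\<phi> \<in> kahler_relations R A \<Longrightarrow> \<phi> \<in> kahler_submodule R A"
  using submodule_span_superset by (fastforce simp: kahler_submodule_def)

text \<open>For this rule and the next two, the difference of the two representatives is one of the
  relations divided out, which is what \<open>coset_eqI\<close> asks for.\<close>

lemma kahler_d_add:
  assumes "f \<in> carrier A" "g \<in> carrier A"
  shows "kahler_d R A (f \<oplus>\<^bsub>A\<^esub> g) = kahler_d R A f \<oplus>\<^bsub>kahler R A\<^esub> kahler_d R A g"
proof -
  have "free_generator A (f \<oplus>\<^bsub>A\<^esub> g) \<ominus>\<^bsub>free_module_on A\<^esub> (free_generator A f \<oplus>\<^bsub>free_module_on A\<^esub> free_generator A g)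
    \<in> kahler_submodule R A"
    using assms by (intro kahler_relations_mem) (unfold kahler_relations_def Let_def, blast)
  then show ?thesis
    using assms unfolding kahler_def kahler_d_def by (simp add: kahler_simps kahler_intros)
qed

lemma kahler_d_smult:
  assumes "r \<in> carrier R" "f \<in> carrier A"
  shows "kahler_d R A (r \<odot>\<^bsub>A\<^esub> f) = (r \<odot>\<^bsub>A\<^esub> \<one>\<^bsub>A\<^esub>) \<odot>\<^bsub>kahler R A\<^esub> kahler_d R A f"
proof -
  have "free_generator A (r \<odot>\<^bsub>A\<^esub> f) \<ominus>\<^bsub>free_module_on A\<^esub> (r \<odot>\<^bsub>restrict_scalars A (free_module_on A)\<^esub> free_generator A f)
    \<in> kahler_submodule R A"
    using assms by (intro kahler_relations_mem) (unfold kahler_relations_def Let_def, blast)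
  then show ?thesis
    using assms unfolding kahler_def kahler_d_def by (simp add: kahler_simps kahler_intros)
qed

lemma kahler_d_mult:
  assumes "f \<in> carrier A" "g \<in> carrier A"
  shows "kahler_d R A (f \<otimes>\<^bsub>A\<^esub> g) =
      f \<odot>\<^bsub>kahler R A\<^esub> kahler_d R A g \<oplus>\<^bsub>kahler R A\<^esub> g \<odot>\<^bsub>kahler R A\<^esub> kahler_d R A f"
proof -
  have "free_generator A (f \<otimes>\<^bsub>A\<^esub> g) \<ominus>\<^bsub>free_module_on A\<^esub> (f \<odot>\<^bsub>free_module_on A\<^esub> free_generator A g \<oplus>\<^bsub>free_module_on A\<^esub> g \<odot>\<^bsub>free_module_on A\<^esub> free_generator A f)
    \<in> kahler_submodule R A"
    using assms by (intro kahler_relations_mem) (unfold kahler_relations_def Let_def, blast)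
  then show ?thesis
    using assms unfolding kahler_def kahler_d_def by (simp add: kahler_simps kahler_intros)
qed

text \<open>Every class has a representative in the free module, and the class of a multiple of the
  generator at \<open>f\<close> is the same multiple of \<open>d f\<close>. Induction on the
  representative therefore descends to \<Omega>.\<close>

lemma kahler_induct [consumes 1, case_names zero add gen]:
  assumes "\<alpha> \<in> carrier (kahler R A)"
    and zero: "P \<zero>\<^bsub>kahler R A\<^esub>"
    and add: "\<And>\<alpha> \<beta>. \<alpha> \<in> carrier (kahler R A) \<Longrightarrow> \<beta> \<in> carrier (kahler R A) \<Longrightarrow>
      P \<alpha> \<Longrightarrow> P \<beta> \<Longrightarrow> P (\<alpha> \<oplus>\<^bsub>kahler R A\<^esub> \<beta>)"
    and gen: "\<And>a f. a \<in> carrier A \<Longrightarrow> f \<in> carrier A \<Longrightarrow> P (a \<odot>\<^bsub>kahler R A\<^esub> kahler_d R A f)"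
  shows "P \<alpha>"
proof -
  let ?N = "kahler_submodule R A" and ?F = "free_module_on A"
  note ms = F.module_axioms submodule_kahler_submodule
  obtain \<phi> where \<phi>: "\<phi> \<in> carrier ?F" "\<alpha> = ?N +>\<^bsub>?F\<^esub> \<phi>"
    using quotient_module_carrierE[OF ms] assms(1) unfolding kahler_def by blast
  interpret Om: module A "kahler R A" by (rule module_kahler)
  \<comment> \<open>The zero of \<Omega> is the submodule itself, whereas the induction on
    representatives starts at the coset of zero.\<close>
  have "?N +>\<^bsub>?F\<^esub> \<zero>\<^bsub>?F\<^esub> = ?N"
    by (metis F.M.a_coset_add_zero F.submoduleE(1) submodule_kahler_submodule)
  then have "P (?N +>\<^bsub>?F\<^esub> \<zero>\<^bsub>?F\<^esub>)"
    using zero by (simp add: kahler_def quotient_module_def)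
  with M_cring \<phi>(1) have "P (?N +>\<^bsub>?F\<^esub> \<phi>)"
  proof (rule free_module_on_induct)
    fix \<phi> \<psi> assume *: "\<phi> \<in> carrier ?F" "\<psi> \<in> carrier ?F" "P (?N +>\<^bsub>?F\<^esub> \<phi>)" "P (?N +>\<^bsub>?F\<^esub> \<psi>)"
    show "P (?N +>\<^bsub>?F\<^esub> (\<phi> \<oplus>\<^bsub>?F\<^esub> \<psi>))"
      using add[of "?N +>\<^bsub>?F\<^esub> \<phi>" "?N +>\<^bsub>?F\<^esub> \<psi>"] *
      by (simp add: kahler_def kahler_simps coset_closed[OF ms])
  next
    fix a f assume "a \<in> carrier A" "f \<in> carrier A"
    then show "P (?N +>\<^bsub>?F\<^esub> (a \<odot>\<^bsub>?F\<^esub> free_generator A f))"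
      using gen[of a f] by (simp add: kahler_def kahler_d_def kahler_simps)
  qed
  with \<phi> show ?thesis by simp
qed

text \<open>The uniqueness half of the universal property of \<open>d\<close>.\<close>

lemma linear_maps_kahler_eqI:
  assumes "u \<in> linear_maps A (kahler R A) N" "v \<in> linear_maps A (kahler R A) N" "abelian_group N"
    and "\<And>f. f \<in> carrier A \<Longrightarrow> u (kahler_d R A f) = v (kahler_d R A f)"
    and "\<alpha> \<in> carrier (kahler R A)"
  shows "u \<alpha> = v \<alpha>"
proof -
  interpret Om: module A "kahler R A" by (rule module_kahler)
  from assms(5) show ?thesis
    by (induction rule: kahler_induct)
      (simp_all add: linear_maps_zero[OF assms(1) Om.M.abelian_group_axioms assms(3)]
        linear_maps_zero[OF assms(2) Om.M.abelian_group_axioms assms(3)]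
        linear_maps_add[OF assms(1)] linear_maps_add[OF assms(2)]
        linear_maps_smult[OF assms(1)] linear_maps_smult[OF assms(2)] kahler_d_closed assms(4))
qed

end

section \<open>Perturbing a Lie bracket\<close>

lemma linear_maps_pointwise_add:
  assumes "module K N" "f \<in> linear_maps K M N" "g \<in> linear_maps K M N"
  shows "(\<lambda>x. f x \<oplus>\<^bsub>N\<^esub> g x) \<in> linear_maps K M N"
proof -
  interpret N: module K N by fact
  show ?thesis
    by (rule linear_mapsI)
      (simp_all add: assms(2,3)[THEN linear_maps_closed] assms(2,3)[THEN linear_maps_add]
        assms(2,3)[THEN linear_maps_smult] N.smult_r_distr N.M.a_ac)
qed

lemma linear_maps_pointwise_uminus:
  assumes "module K N" "f \<in> linear_maps K M N"
  shows "(\<lambda>x. \<ominus>\<^bsub>N\<^esub> f x) \<in> linear_maps K M N"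
proof -
  interpret N: module K N by fact
  show ?thesis
    by (rule linear_mapsI)
      (simp_all add: assms(2)[THEN linear_maps_closed] assms(2)[THEN linear_maps_add]
        assms(2)[THEN linear_maps_smult] N.smult_r_minus N.M.minus_add)
qed

lemma linear_maps_pointwise_smult:
  assumes "module K N" "a \<in> carrier K" "f \<in> linear_maps K M N"
  shows "(\<lambda>x. a \<odot>\<^bsub>N\<^esub> f x) \<in> linear_maps K M N"
proof -
  interpret N: module K N by fact
  show ?thesis
    by (rule linear_mapsI)
      (simp_all add: assms(2) assms(3)[THEN linear_maps_closed] assms(3)[THEN linear_maps_add]
        assms(3)[THEN linear_maps_smult] N.smult_r_distr N.R.m_comm flip: N.smult_assoc1)
qed

text \<open>Linearity constrains values on the carrier only. The module structure of
  \<open>M\<close> keeps sums and multiples inside the carrier, where \<open>f\<close> and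
  \<open>g\<close> agree.\<close>

lemma linear_maps_cong:
  assumes "f \<in> linear_maps K M N" "module K M"
    and "\<And>x. x \<in> carrier M \<Longrightarrow> f x = g x"
  shows "g \<in> linear_maps K M N"
proof -
  interpret M: module K M by fact
  show ?thesis
    by (rule linear_mapsI)
      (simp_all flip: assms(3) add: assms(1)[THEN linear_maps_closed] assms(1)[THEN linear_maps_add]
        assms(1)[THEN linear_maps_smult])
qed

text \<open>Up to sign the first slot is the second one, so the skew-symmetric maps below are
  checked in one slot only.\<close>

lemma bilinear_mapsI_skew:
  assumes "module K M" "module K N"
    and lin: "\<And>x. x \<in> carrier M \<Longrightarrow> b x \<in> linear_maps K M N"
    and skew: "skew_symmetric_on (carrier M) N b"
  shows "b \<in> bilinear_maps K M M N"
proof -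
  interpret M: module K M by fact
  have "(\<lambda>x. b x y) \<in> linear_maps K M N" if y: "y \<in> carrier M" for y
    by (rule linear_maps_cong[OF linear_maps_pointwise_uminus[OF assms(2) lin[OF y]]
            assms(1)])
      (metis skew y skew_symmetric_on_def)
  with lin show ?thesis by (simp add: bilinear_maps_def)
qed

lemma bilinear_maps_closed:
  "b \<in> bilinear_maps K L M N \<Longrightarrow> x \<in> carrier L \<Longrightarrow> y \<in> carrier M \<Longrightarrow> b x y \<in> carrier N"
  by (auto simp: bilinear_maps_def linear_maps_def)

lemma derivations_pointwise_add:
  assumes "algebra R A" "\<delta> \<in> derivations R A" "\<epsilon> \<in> derivations R A"
  shows "(\<lambda>x. \<delta> x \<oplus>\<^bsub>A\<^esub> \<epsilon> x) \<in> derivations R A"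
proof -
  interpret A: algebra R A by fact
  have lin: "\<delta> \<in> linear_maps R A A" "\<epsilon> \<in> linear_maps R A A"
    using assms(2,3) by (auto simp: derivations_def)
  have "\<delta> (f \<otimes>\<^bsub>A\<^esub> g) \<oplus>\<^bsub>A\<^esub> \<epsilon> (f \<otimes>\<^bsub>A\<^esub> g) =
      (\<delta> f \<oplus>\<^bsub>A\<^esub> \<epsilon> f) \<otimes>\<^bsub>A\<^esub> g \<oplus>\<^bsub>A\<^esub> f \<otimes>\<^bsub>A\<^esub> (\<delta> g \<oplus>\<^bsub>A\<^esub> \<epsilon> g)"
    if "f \<in> carrier A" "g \<in> carrier A" for f g
  proof -
    have "\<delta> (f \<otimes>\<^bsub>A\<^esub> g) = \<delta> f \<otimes>\<^bsub>A\<^esub> g \<oplus>\<^bsub>A\<^esub> f \<otimes>\<^bsub>A\<^esub> \<delta> g" "\<epsilon> (f \<otimes>\<^bsub>A\<^esub> g) = \<epsilon> f \<otimes>\<^bsub>A\<^esub> g \<oplus>\<^bsub>A\<^esub> f \<otimes>\<^bsub>A\<^esub> \<epsilon> g"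
      using assms(2,3) that by (simp_all add: derivations_def)
    with that show ?thesis
      by (simp add: lin[THEN linear_maps_closed] A.l_distr A.r_distr A.M.a_ac)
  qed
  with linear_maps_pointwise_add[OF A.module lin] show ?thesis
    by (simp add: derivations_def)
qed

text \<open>The Jacobiator of \<open>b + c\<close> splits into that of \<open>b\<close>, the mixed
  terms collected in \<open>jac\<close>, and the part quadratic in \<open>c\<close>, which
  \<open>nil\<close> kills termwise. Bilinearity and skew-symmetry are inherited by sums.\<close>

lemma lie_bracket_perturb:
  assumes "module K M" "lie_bracket K M b"
    and c: "c \<in> bilinear_maps K M M M" "skew_symmetric_on (carrier M) M c"
    and nil: "\<And>x y z. x \<in> carrier M \<Longrightarrow> y \<in> carrier M \<Longrightarrow> z \<in> carrier M \<Longrightarrow> c x (c y z) = \<zero>\<^bsub>M\<^esub>"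
    and jac: "\<And>x y z. x \<in> carrier M \<Longrightarrow> y \<in> carrier M \<Longrightarrow> z \<in> carrier M \<Longrightarrow>
      (b x (c y z) \<oplus>\<^bsub>M\<^esub> c x (b y z)) \<oplus>\<^bsub>M\<^esub> (b y (c z x) \<oplus>\<^bsub>M\<^esub> c y (b z x)) \<oplus>\<^bsub>M\<^esub>
      (b z (c x y) \<oplus>\<^bsub>M\<^esub> c z (b x y)) = \<zero>\<^bsub>M\<^esub>"
  shows "lie_bracket K M (\<lambda>x y. b x y \<oplus>\<^bsub>M\<^esub> c x y)"
proof -
  interpret M: module K M by fact
  have b: "b \<in> bilinear_maps K M M M" "skew_symmetric_on (carrier M) M b"
    using assms(2) by (auto simp: lie_bracket_def)
  note cl = b(1)[THEN bilinear_maps_closed] c(1)[THEN bilinear_maps_closed]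
  have lin: "b x \<in> linear_maps K M M" "c x \<in> linear_maps K M M" if "x \<in> carrier M" for x
    using that b c by (auto simp: bilinear_maps_def)
  show ?thesis
    unfolding lie_bracket_def
  proof (intro conjI ballI)
    show "(\<lambda>x y. b x y \<oplus>\<^bsub>M\<^esub> c x y) \<in> bilinear_maps K M M M"
      using b(1) c(1) by (auto simp: bilinear_maps_def intro!: linear_maps_pointwise_add assms(1))
    show "skew_symmetric_on (carrier M) M (\<lambda>x y. b x y \<oplus>\<^bsub>M\<^esub> c x y)"
      unfolding skew_symmetric_on_def
    proof (intro ballI)
      fix x y assume xy: "x \<in> carrier M" "y \<in> carrier M"
      then have "b x y = \<ominus>\<^bsub>M\<^esub> b y x" "c x y = \<ominus>\<^bsub>M\<^esub> c y x"
        using b(2) c(2) unfolding skew_symmetric_on_def by blast+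
      then show "b x y \<oplus>\<^bsub>M\<^esub> c x y = \<ominus>\<^bsub>M\<^esub> (b y x \<oplus>\<^bsub>M\<^esub> c y x)"
        using xy by (simp only: M.M.minus_add cl)
    qed
  next
    fix x y z assume xyz: "x \<in> carrier M" "y \<in> carrier M" "z \<in> carrier M"
    have e: "b u (b v w \<oplus>\<^bsub>M\<^esub> c v w) \<oplus>\<^bsub>M\<^esub> c u (b v w \<oplus>\<^bsub>M\<^esub> c v w) =
        b u (b v w) \<oplus>\<^bsub>M\<^esub> (b u (c v w) \<oplus>\<^bsub>M\<^esub> c u (b v w))"
      if "u \<in> carrier M" "v \<in> carrier M" "w \<in> carrier M" for u v w
      using that by (simp add: lin[THEN linear_maps_add] cl nil M.M.a_ac)
    have J: "b x (b y z) \<oplus>\<^bsub>M\<^esub> b y (b z x) \<oplus>\<^bsub>M\<^esub> b z (b x y) = \<zero>\<^bsub>M\<^esub>"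
      using assms(2) xyz by (simp add: lie_bracket_def)
    \<comment> \<open>Regroups the three expanded summands so that the Jacobiator of
      \<open>b\<close> and the cyclic sum of mixed terms stand apart, each being zero.\<close>
    have ac: "(p \<oplus>\<^bsub>M\<^esub> p') \<oplus>\<^bsub>M\<^esub> (q \<oplus>\<^bsub>M\<^esub> q') \<oplus>\<^bsub>M\<^esub> (r \<oplus>\<^bsub>M\<^esub> r') =
        (p \<oplus>\<^bsub>M\<^esub> q \<oplus>\<^bsub>M\<^esub> r) \<oplus>\<^bsub>M\<^esub> (p' \<oplus>\<^bsub>M\<^esub> q' \<oplus>\<^bsub>M\<^esub> r')"
      if "p \<in> carrier M" "p' \<in> carrier M" "q \<in> carrier M" "q' \<in> carrier M" "r \<in> carrier M" "r' \<in> carrier M"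
      for p p' q q' r r'
      using that by (simp add: M.M.a_ac)
    show "b x (b y z \<oplus>\<^bsub>M\<^esub> c y z) \<oplus>\<^bsub>M\<^esub> c x (b y z \<oplus>\<^bsub>M\<^esub> c y z) \<oplus>\<^bsub>M\<^esub>
        (b y (b z x \<oplus>\<^bsub>M\<^esub> c z x) \<oplus>\<^bsub>M\<^esub> c y (b z x \<oplus>\<^bsub>M\<^esub> c z x)) \<oplus>\<^bsub>M\<^esub>
        (b z (b x y \<oplus>\<^bsub>M\<^esub> c x y) \<oplus>\<^bsub>M\<^esub> c z (b x y \<oplus>\<^bsub>M\<^esub> c x y)) = \<zero>\<^bsub>M\<^esub>"
      using xyz by (simp only: e) (subst ac, simp_all add: cl J jac)
  qed
qed

section \<open>The semidirect product and the center\<close>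

lemma semidirect_simps [simp]:
  "carrier (semidirect P\<^sub>0 P\<^sub>1) = carrier P\<^sub>0 \<times> carrier P\<^sub>1"
  "(f, \<eta>) \<otimes>\<^bsub>semidirect P\<^sub>0 P\<^sub>1\<^esub> (g, \<xi>) = (f \<otimes>\<^bsub>P\<^sub>0\<^esub> g, f \<odot>\<^bsub>P\<^sub>1\<^esub> \<xi> \<oplus>\<^bsub>P\<^sub>1\<^esub> g \<odot>\<^bsub>P\<^sub>1\<^esub> \<eta>)"
  "\<zero>\<^bsub>semidirect P\<^sub>0 P\<^sub>1\<^esub> = (\<zero>\<^bsub>P\<^sub>0\<^esub>, \<zero>\<^bsub>P\<^sub>1\<^esub>)"
  "(f, \<eta>) \<oplus>\<^bsub>semidirect P\<^sub>0 P\<^sub>1\<^esub> (g, \<xi>) = (f \<oplus>\<^bsub>P\<^sub>0\<^esub> g, \<eta> \<oplus>\<^bsub>P\<^sub>1\<^esub> \<xi>)"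
  "r \<odot>\<^bsub>semidirect P\<^sub>0 P\<^sub>1\<^esub> (f, \<eta>) = (r \<odot>\<^bsub>P\<^sub>0\<^esub> f, (r \<odot>\<^bsub>P\<^sub>0\<^esub> \<one>\<^bsub>P\<^sub>0\<^esub>) \<odot>\<^bsub>P\<^sub>1\<^esub> \<eta>)"
  by (simp_all add: semidirect_def)

text \<open>The center is the common kernel of the linear maps that send \<open>x\<close> to
  \<open>b x y\<close>.\<close>

lemma bracket_center_submodule:
  assumes "module K M" "lie_bracket K M b"
  shows "submodule (bracket_center M b) K M"
proof -
  interpret M: module K M by fact
  have l: "(\<lambda>x. b x y) \<in> linear_maps K M M" if "y \<in> carrier M" for y
    using assms(2) that by (auto simp: lie_bracket_def bilinear_maps_def)
  note l' = l[THEN linear_maps_add] l[THEN linear_maps_smult]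
    linear_maps_uminus[OF l M.M.abelian_group_axioms M.M.abelian_group_axioms]
    linear_maps_zero[OF l M.M.abelian_group_axioms M.M.abelian_group_axioms]
  show ?thesis
    by (rule M.submoduleI) (auto simp: bracket_center_def l')
qed

section \<open>Admissible Poisson algebras and their triples\<close>

locale admissible_poisson_triple =
  fixes R :: "('r, 'rx) ring_scheme"
    and P\<^sub>0 :: "('r, 'a, 'ax) module_scheme"
    and P\<^sub>1 :: "('a, 'm, 'mx) module_scheme"
    and br\<^sub>0 :: "'a \<Rightarrow> 'a \<Rightarrow> 'a"
    and \<rho> :: "('a \<Rightarrow> 'a) set \<Rightarrow> 'a \<Rightarrow> 'a"
    and lb :: "('a \<Rightarrow> 'a) set \<Rightarrow> ('a \<Rightarrow> 'a) set \<Rightarrow> ('a \<Rightarrow> 'a) set"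
    and br :: "'a \<times> 'm \<Rightarrow> 'a \<times> 'm \<Rightarrow> 'a \<times> 'm"
    and br\<^sub>1 :: "'m \<Rightarrow> 'm \<Rightarrow> 'm"
    and D :: "('a \<Rightarrow> 'a) set \<Rightarrow> 'm \<Rightarrow> 'm"
    and \<K> :: "('a \<Rightarrow> 'a) set \<Rightarrow> ('a \<Rightarrow> 'a) set \<Rightarrow> 'm"
  assumes poisson: "poisson_algebra R P\<^sub>0 br\<^sub>0"
    and module_P1: "module P\<^sub>0 P\<^sub>1"
    and anchor: "poisson_anchor R P\<^sub>0 br\<^sub>0 \<rho>"
    and kahler_bracket: "kahler_lie_bracket R P\<^sub>0 br\<^sub>0 \<rho> lb"
    and admissible: "admissible_poisson R P\<^sub>0 br\<^sub>0 P\<^sub>1 br"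
    and triple: "corresponding_triple R P\<^sub>0 br\<^sub>0 \<rho> P\<^sub>1 br br\<^sub>1 D \<K>"
begin

abbreviation "\<Omega> \<equiv> kahler R P\<^sub>0"
abbreviation "d \<equiv> kahler_d R P\<^sub>0"
abbreviation "P \<equiv> semidirect P\<^sub>0 P\<^sub>1"
abbreviation "Z \<equiv> bracket_center P\<^sub>1 br\<^sub>1"

lemma algebra_P0: "algebra R P\<^sub>0"
  using poisson by (simp add: poisson_algebra_def)

lemma algebra_P: "algebra R P"
  using admissible by (simp add: admissible_poisson_def poisson_algebra_def)

sublocale P0: algebra R P\<^sub>0 by (rule algebra_P0)
sublocale P1: module P\<^sub>0 P\<^sub>1 by (rule module_P1)
sublocale Om: module P\<^sub>0 \<Omega> by (rule module_kahler[OF algebra_P0])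
sublocale P: algebra R P by (rule algebra_P)

lemmas d_closed [simp] = kahler_d_closed[OF algebra_P0]
lemmas d_add = kahler_d_add[OF algebra_P0]
lemmas d_smult = kahler_d_smult[OF algebra_P0]
lemmas d_mult = kahler_d_mult[OF algebra_P0]

lemma minus_zero_P1 [simp]: "\<ominus>\<^bsub>P\<^sub>1\<^esub> \<zero>\<^bsub>P\<^sub>1\<^esub> = \<zero>\<^bsub>P\<^sub>1\<^esub>"
  by (simp add: a_inv_def)

lemma abelian_group_scalars [simp]:
  "abelian_group (restrict_scalars P\<^sub>0 P\<^sub>1)" "abelian_group (restrict_scalars P\<^sub>0 \<Omega>)"
  by (intro abelian_group_restrict_scalars P1.M.abelian_group_axioms Om.M.abelian_group_axioms)+

lemma d_linear: "d \<in> linear_maps R P\<^sub>0 (restrict_scalars P\<^sub>0 \<Omega>)"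
  by (rule linear_mapsI) (simp_all add: d_add d_smult)

lemma d_zero [simp]: "d \<zero>\<^bsub>P\<^sub>0\<^esub> = \<zero>\<^bsub>\<Omega>\<^esub>"
  using linear_maps_zero[OF d_linear P0.M.abelian_group_axioms] by simp

lemma scalar_closed [simp]: "r \<in> carrier R \<Longrightarrow> r \<odot>\<^bsub>P\<^sub>0\<^esub> \<one>\<^bsub>P\<^sub>0\<^esub> \<in> carrier P\<^sub>0"
  by simp

text \<open>Bilinearity holds over \<open>R\<close>, hence the restricted modules; a factor from
  \<open>P\<^sub>0\<close> in the second slot produces the anchor term of
  \<open>lb_leibniz\<close>.\<close>

lemma lb_bilinear: "lb \<in> bilinear_maps R (restrict_scalars P\<^sub>0 \<Omega>) (restrict_scalars P\<^sub>0 \<Omega>) (restrict_scalars P\<^sub>0 \<Omega>)"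
  using kahler_bracket by (simp add: kahler_lie_bracket_def Let_def lie_bracket_def)

lemma lb_closed [simp]: "\<alpha> \<in> carrier \<Omega> \<Longrightarrow> \<beta> \<in> carrier \<Omega> \<Longrightarrow> lb \<alpha> \<beta> \<in> carrier \<Omega>"
  using bilinear_maps_closed[OF lb_bilinear] by simp

lemma lb_add_right:
  "\<alpha> \<in> carrier \<Omega> \<Longrightarrow> \<beta> \<in> carrier \<Omega> \<Longrightarrow> \<gamma> \<in> carrier \<Omega> \<Longrightarrow> lb \<alpha> (\<beta> \<oplus>\<^bsub>\<Omega>\<^esub> \<gamma>) = lb \<alpha> \<beta> \<oplus>\<^bsub>\<Omega>\<^esub> lb \<alpha> \<gamma>"
  using lb_bilinear by (auto simp: bilinear_maps_def linear_maps_def)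

lemma lb_skew: "\<alpha> \<in> carrier \<Omega> \<Longrightarrow> \<beta> \<in> carrier \<Omega> \<Longrightarrow> lb \<alpha> \<beta> = \<ominus>\<^bsub>\<Omega>\<^esub> lb \<beta> \<alpha>"
  using kahler_bracket
  unfolding kahler_lie_bracket_def Let_def lie_bracket_def skew_symmetric_on_def
    restrict_scalars_simps a_inv_restrict_scalars by blast

lemma lb_d: "f \<in> carrier P\<^sub>0 \<Longrightarrow> g \<in> carrier P\<^sub>0 \<Longrightarrow> lb (d f) (d g) = d (br\<^sub>0 f g)"
  using kahler_bracket by (simp add: kahler_lie_bracket_def Let_def)

lemma lb_leibniz:
  "\<alpha> \<in> carrier \<Omega> \<Longrightarrow> \<beta> \<in> carrier \<Omega> \<Longrightarrow> f \<in> carrier P\<^sub>0 \<Longrightarrow>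
    lb \<alpha> (f \<odot>\<^bsub>\<Omega>\<^esub> \<beta>) = f \<odot>\<^bsub>\<Omega>\<^esub> lb \<alpha> \<beta> \<oplus>\<^bsub>\<Omega>\<^esub> \<rho> \<alpha> f \<odot>\<^bsub>\<Omega>\<^esub> \<beta>"
  using kahler_bracket by (simp add: kahler_lie_bracket_def Let_def)

lemma anchor_closed [simp]: "\<alpha> \<in> carrier \<Omega> \<Longrightarrow> f \<in> carrier P\<^sub>0 \<Longrightarrow> \<rho> \<alpha> f \<in> carrier P\<^sub>0"
  using anchor by (auto simp: poisson_anchor_def Let_def derivations_def linear_maps_def)

lemma D_bilinear: "D \<in> bilinear_maps R (restrict_scalars P\<^sub>0 \<Omega>) (restrict_scalars P\<^sub>0 P\<^sub>1) (restrict_scalars P\<^sub>0 P\<^sub>1)"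
  using triple by (simp add: corresponding_triple_def contravariant_derivative_def Let_def)

lemma D_linear:
  "\<alpha> \<in> carrier \<Omega> \<Longrightarrow> D \<alpha> \<in> linear_maps R (restrict_scalars P\<^sub>0 P\<^sub>1) (restrict_scalars P\<^sub>0 P\<^sub>1)"
  "\<eta> \<in> carrier P\<^sub>1 \<Longrightarrow> (\<lambda>\<alpha>. D \<alpha> \<eta>) \<in> linear_maps R (restrict_scalars P\<^sub>0 \<Omega>) (restrict_scalars P\<^sub>0 P\<^sub>1)"
  using D_bilinear by (simp_all add: bilinear_maps_def)

lemma D_closed [simp]: "\<alpha> \<in> carrier \<Omega> \<Longrightarrow> \<eta> \<in> carrier P\<^sub>1 \<Longrightarrow> D \<alpha> \<eta> \<in> carrier P\<^sub>1"
  using bilinear_maps_closed[OF D_bilinear] by simp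

lemma D_add_right:
  "\<alpha> \<in> carrier \<Omega> \<Longrightarrow> \<eta> \<in> carrier P\<^sub>1 \<Longrightarrow> \<xi> \<in> carrier P\<^sub>1 \<Longrightarrow> D \<alpha> (\<eta> \<oplus>\<^bsub>P\<^sub>1\<^esub> \<xi>) = D \<alpha> \<eta> \<oplus>\<^bsub>P\<^sub>1\<^esub> D \<alpha> \<xi>"
  using linear_maps_add[OF D_linear(1)] by simp

lemma D_add_left:
  "\<alpha> \<in> carrier \<Omega> \<Longrightarrow> \<beta> \<in> carrier \<Omega> \<Longrightarrow> \<eta> \<in> carrier P\<^sub>1 \<Longrightarrow> D (\<alpha> \<oplus>\<^bsub>\<Omega>\<^esub> \<beta>) \<eta> = D \<alpha> \<eta> \<oplus>\<^bsub>P\<^sub>1\<^esub> D \<beta> \<eta>"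
  using linear_maps_add[OF D_linear(2)] by simp

lemma D_scalar:
  "\<alpha> \<in> carrier \<Omega> \<Longrightarrow> \<eta> \<in> carrier P\<^sub>1 \<Longrightarrow> r \<in> carrier R \<Longrightarrow>
    D \<alpha> ((r \<odot>\<^bsub>P\<^sub>0\<^esub> \<one>\<^bsub>P\<^sub>0\<^esub>) \<odot>\<^bsub>P\<^sub>1\<^esub> \<eta>) = (r \<odot>\<^bsub>P\<^sub>0\<^esub> \<one>\<^bsub>P\<^sub>0\<^esub>) \<odot>\<^bsub>P\<^sub>1\<^esub> D \<alpha> \<eta>"
  using linear_maps_smult[OF D_linear(1)] by simp

lemma D_zero_right [simp]: "\<alpha> \<in> carrier \<Omega> \<Longrightarrow> D \<alpha> \<zero>\<^bsub>P\<^sub>1\<^esub> = \<zero>\<^bsub>P\<^sub>1\<^esub>"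
  using linear_maps_zero[OF D_linear(1)] by simp

lemma D_zero_left [simp]: "\<eta> \<in> carrier P\<^sub>1 \<Longrightarrow> D \<zero>\<^bsub>\<Omega>\<^esub> \<eta> = \<zero>\<^bsub>P\<^sub>1\<^esub>"
  using linear_maps_zero[OF D_linear(2)]
  by simp

lemma D_uminus_right:
  "\<alpha> \<in> carrier \<Omega> \<Longrightarrow> \<eta> \<in> carrier P\<^sub>1 \<Longrightarrow> D \<alpha> (\<ominus>\<^bsub>P\<^sub>1\<^esub> \<eta>) = \<ominus>\<^bsub>P\<^sub>1\<^esub> D \<alpha> \<eta>"
  using linear_maps_uminus[OF D_linear(1)] by simp

lemma D_smult_left:
  "\<alpha> \<in> carrier \<Omega> \<Longrightarrow> \<eta> \<in> carrier P\<^sub>1 \<Longrightarrow> f \<in> carrier P\<^sub>0 \<Longrightarrow> D (f \<odot>\<^bsub>\<Omega>\<^esub> \<alpha>) \<eta> = f \<odot>\<^bsub>P\<^sub>1\<^esub> D \<alpha> \<eta>"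
  using triple by (simp add: corresponding_triple_def contravariant_derivative_def Let_def)

lemma D_leibniz:
  "\<alpha> \<in> carrier \<Omega> \<Longrightarrow> \<eta> \<in> carrier P\<^sub>1 \<Longrightarrow> f \<in> carrier P\<^sub>0 \<Longrightarrow>
    D \<alpha> (f \<odot>\<^bsub>P\<^sub>1\<^esub> \<eta>) = f \<odot>\<^bsub>P\<^sub>1\<^esub> D \<alpha> \<eta> \<oplus>\<^bsub>P\<^sub>1\<^esub> \<rho> \<alpha> f \<odot>\<^bsub>P\<^sub>1\<^esub> \<eta>"
  using triple by (simp add: corresponding_triple_def contravariant_derivative_def Let_def)

lemma lie_bracket_br1: "lie_bracket P\<^sub>0 P\<^sub>1 br\<^sub>1"
  using triple by (simp add: corresponding_triple_def Let_def)

lemma br1_bilinear: "br\<^sub>1 \<in> bilinear_maps P\<^sub>0 P\<^sub>1 P\<^sub>1 P\<^sub>1"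
  using lie_bracket_br1 by (simp add: lie_bracket_def)

lemma br1_closed [simp]: "\<eta> \<in> carrier P\<^sub>1 \<Longrightarrow> \<xi> \<in> carrier P\<^sub>1 \<Longrightarrow> br\<^sub>1 \<eta> \<xi> \<in> carrier P\<^sub>1"
  by (rule bilinear_maps_closed[OF br1_bilinear])

lemma br1_add:
  "\<eta> \<in> carrier P\<^sub>1 \<Longrightarrow> \<eta>' \<in> carrier P\<^sub>1 \<Longrightarrow> \<xi> \<in> carrier P\<^sub>1 \<Longrightarrow> br\<^sub>1 (\<eta> \<oplus>\<^bsub>P\<^sub>1\<^esub> \<eta>') \<xi> = br\<^sub>1 \<eta> \<xi> \<oplus>\<^bsub>P\<^sub>1\<^esub> br\<^sub>1 \<eta>' \<xi>"
  "\<eta> \<in> carrier P\<^sub>1 \<Longrightarrow> \<eta>' \<in> carrier P\<^sub>1 \<Longrightarrow> \<xi> \<in> carrier P\<^sub>1 \<Longrightarrow> br\<^sub>1 \<xi> (\<eta> \<oplus>\<^bsub>P\<^sub>1\<^esub> \<eta>') = br\<^sub>1 \<xi> \<eta> \<oplus>\<^bsub>P\<^sub>1\<^esub> br\<^sub>1 \<xi> \<eta>'"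
  using br1_bilinear by (simp_all add: bilinear_maps_def linear_maps_def)

lemma center_closed: "\<zeta> \<in> Z \<Longrightarrow> \<zeta> \<in> carrier P\<^sub>1"
  by (simp add: bracket_center_def)

text \<open>The center is defined by the left slot; skew-symmetry carries the vanishing over to the
  right slot.\<close>

lemma br1_center:
  assumes "\<zeta> \<in> Z" "\<eta> \<in> carrier P\<^sub>1"
  shows "br\<^sub>1 \<zeta> \<eta> = \<zero>\<^bsub>P\<^sub>1\<^esub>" "br\<^sub>1 \<eta> \<zeta> = \<zero>\<^bsub>P\<^sub>1\<^esub>"
proof -
  show "br\<^sub>1 \<zeta> \<eta> = \<zero>\<^bsub>P\<^sub>1\<^esub>" using assms by (simp add: bracket_center_def)
  moreover have "br\<^sub>1 \<eta> \<zeta> = \<ominus>\<^bsub>P\<^sub>1\<^esub> br\<^sub>1 \<zeta> \<eta>"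
    using lie_bracket_br1 assms center_closed unfolding lie_bracket_def skew_symmetric_on_def by blast
  ultimately show "br\<^sub>1 \<eta> \<zeta> = \<zero>\<^bsub>P\<^sub>1\<^esub>" by simp
qed

lemmas submodule_center = bracket_center_submodule[OF module_P1 lie_bracket_br1]

lemma center_mem [simp]:
  "\<zero>\<^bsub>P\<^sub>1\<^esub> \<in> Z"
  "\<zeta> \<in> Z \<Longrightarrow> \<ominus>\<^bsub>P\<^sub>1\<^esub> \<zeta> \<in> Z"
  "\<zeta> \<in> Z \<Longrightarrow> \<zeta>' \<in> Z \<Longrightarrow> \<zeta> \<oplus>\<^bsub>P\<^sub>1\<^esub> \<zeta>' \<in> Z"
  "a \<in> carrier P\<^sub>0 \<Longrightarrow> \<zeta> \<in> Z \<Longrightarrow> a \<odot>\<^bsub>P\<^sub>1\<^esub> \<zeta> \<in> Z"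
  using P1.submoduleE[OF submodule_center] subgroup.one_closed[OF submodule.axioms(1)[OF submodule_center]]
  by simp_all

lemma K_bilinear: "\<K> \<in> bilinear_maps P\<^sub>0 \<Omega> \<Omega> P\<^sub>1"
  using triple by (simp add: corresponding_triple_def Let_def)

lemma K_closed [simp]: "\<alpha> \<in> carrier \<Omega> \<Longrightarrow> \<beta> \<in> carrier \<Omega> \<Longrightarrow> \<K> \<alpha> \<beta> \<in> carrier P\<^sub>1"
  by (rule bilinear_maps_closed[OF K_bilinear])

lemma br_eq:
  "f \<in> carrier P\<^sub>0 \<Longrightarrow> \<eta> \<in> carrier P\<^sub>1 \<Longrightarrow> g \<in> carrier P\<^sub>0 \<Longrightarrow> \<xi> \<in> carrier P\<^sub>1 \<Longrightarrow>
    br (f, \<eta>) (g, \<xi>) =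
      (br\<^sub>0 f g, D (d f) \<xi> \<ominus>\<^bsub>P\<^sub>1\<^esub> D (d g) \<eta> \<oplus>\<^bsub>P\<^sub>1\<^esub> br\<^sub>1 \<eta> \<xi> \<oplus>\<^bsub>P\<^sub>1\<^esub> \<K> (d f) (d g))"
  using triple by (simp add: corresponding_triple_def Let_def)

lemma br0_closed [simp]: "f \<in> carrier P\<^sub>0 \<Longrightarrow> g \<in> carrier P\<^sub>0 \<Longrightarrow> br\<^sub>0 f g \<in> carrier P\<^sub>0"
  using poisson bilinear_maps_closed[of br\<^sub>0] unfolding poisson_algebra_def lie_bracket_def by blast

lemma lie_bracket_br: "lie_bracket R P br"
  using admissible unfolding admissible_poisson_def poisson_algebra_def by blast

lemma br_derivation:
  "x \<in> carrier P \<Longrightarrow> br x \<in> derivations R P" "x \<in> carrier P \<Longrightarrow> (\<lambda>y. br y x) \<in> derivations R P"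
  using admissible unfolding admissible_poisson_def poisson_algebra_def by blast+

lemma br_closed: "x \<in> carrier P \<Longrightarrow> y \<in> carrier P \<Longrightarrow> br x y \<in> carrier P"
  using lie_bracket_br bilinear_maps_closed[of br] unfolding lie_bracket_def by blast

lemma fst_br: "x \<in> carrier P \<Longrightarrow> y \<in> carrier P \<Longrightarrow> fst (br x y) = br\<^sub>0 (fst x) (fst y)"
  using admissible unfolding admissible_poisson_def by blast

end

section \<open>Cochains in low degree\<close>

lemma tuples_1: "xs \<in> tuples \<Omega> (Suc 0) \<longleftrightarrow> (\<exists>\<alpha>\<in>carrier \<Omega>. xs = [\<alpha>])"
  by (auto simp: tuples_def length_Suc_conv)

lemma tuples_2: "xs \<in> tuples \<Omega> (Suc (Suc 0)) \<longleftrightarrow> (\<exists>\<alpha>\<in>carrier \<Omega>. \<exists>\<beta>\<in>carrier \<Omega>. xs = [\<alpha>, \<beta>])"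
  by (auto simp: tuples_def length_Suc_conv)

lemma index_pairs_1: "{(i, j). i < j \<and> j \<le> Suc 0} = {(0, Suc 0)}"
  by auto

lemma index_pairs_2: "{(i, j). i < j \<and> j \<le> (2::nat)} = {(0, 1), (0, 2), (1, 2)}"
  by (auto simp: le_Suc_eq numeral_2_eq_2)

lemma atMost_2: "{..2::nat} = {0, 1, 2}"
  by (auto simp: le_Suc_eq numeral_2_eq_2)

text \<open>The only index pair is (0, 1). Its odd sum gives the last minus sign, and deleting both
  entries leaves the bracket alone in the list.\<close>

lemma coboundary_1:
  assumes "abelian_group P\<^sub>1" and D: "\<And>\<alpha> \<eta>. \<alpha> \<in> carrier \<Omega> \<Longrightarrow> \<eta> \<in> carrier P\<^sub>1 \<Longrightarrow> D \<alpha> \<eta> \<in> carrier P\<^sub>1"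
    and lb: "\<And>\<alpha> \<beta>. \<alpha> \<in> carrier \<Omega> \<Longrightarrow> \<beta> \<in> carrier \<Omega> \<Longrightarrow> lb \<alpha> \<beta> \<in> carrier \<Omega>"
    and Q: "\<And>\<alpha>. \<alpha> \<in> carrier \<Omega> \<Longrightarrow> Q [\<alpha>] \<in> carrier P\<^sub>1"
    and \<alpha>\<beta>: "\<alpha> \<in> carrier \<Omega>" "\<beta> \<in> carrier \<Omega>"
  shows "coboundary \<Omega> lb P\<^sub>1 D (Suc 0) Q [\<alpha>, \<beta>] =
    D \<alpha> (Q [\<beta>]) \<ominus>\<^bsub>P\<^sub>1\<^esub> D \<beta> (Q [\<alpha>]) \<ominus>\<^bsub>P\<^sub>1\<^esub> Q [lb \<alpha> \<beta>]"
proof -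
  interpret abelian_group P\<^sub>1 by fact
  have "[\<alpha>, \<beta>] \<in> tuples \<Omega> (Suc (Suc 0))" using \<alpha>\<beta> by (simp add: tuples_2)
  then show ?thesis
    using \<alpha>\<beta>
    by (simp add: coboundary_def index_pairs_1 atMost_Suc alt_sign_def nths_Cons D lb Q a_minus_def a_comm)
qed

text \<open>Among the pairs only (0, 2) has an even sum, so the term with
  \<open>lb \<alpha> \<gamma>\<close> is the single positive one in the bracket part.\<close>

lemma coboundary_2:
  assumes "abelian_group P\<^sub>1" and D: "\<And>\<alpha> \<eta>. \<alpha> \<in> carrier \<Omega> \<Longrightarrow> \<eta> \<in> carrier P\<^sub>1 \<Longrightarrow> D \<alpha> \<eta> \<in> carrier P\<^sub>1"
    and lb: "\<And>\<alpha> \<beta>. \<alpha> \<in> carrier \<Omega> \<Longrightarrow> \<beta> \<in> carrier \<Omega> \<Longrightarrow> lb \<alpha> \<beta> \<in> carrier \<Omega>"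
    and Q: "\<And>\<alpha> \<beta>. \<alpha> \<in> carrier \<Omega> \<Longrightarrow> \<beta> \<in> carrier \<Omega> \<Longrightarrow> Q [\<alpha>, \<beta>] \<in> carrier P\<^sub>1"
    and \<alpha>\<beta>: "\<alpha> \<in> carrier \<Omega>" "\<beta> \<in> carrier \<Omega>" "\<gamma> \<in> carrier \<Omega>"
  shows "coboundary \<Omega> lb P\<^sub>1 D 2 Q [\<alpha>, \<beta>, \<gamma>] =
    (D \<alpha> (Q [\<beta>, \<gamma>]) \<ominus>\<^bsub>P\<^sub>1\<^esub> D \<beta> (Q [\<alpha>, \<gamma>]) \<oplus>\<^bsub>P\<^sub>1\<^esub> D \<gamma> (Q [\<alpha>, \<beta>])) \<oplus>\<^bsub>P\<^sub>1\<^esub>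
    (Q [lb \<alpha> \<gamma>, \<beta>] \<ominus>\<^bsub>P\<^sub>1\<^esub> Q [lb \<alpha> \<beta>, \<gamma>] \<ominus>\<^bsub>P\<^sub>1\<^esub> Q [lb \<beta> \<gamma>, \<alpha>])"
proof -
  interpret abelian_group P\<^sub>1 by fact
  have "[\<alpha>, \<beta>, \<gamma>] \<in> tuples \<Omega> (Suc 2)" using \<alpha>\<beta> by (simp add: tuples_def)
  then have "coboundary \<Omega> lb P\<^sub>1 D 2 Q [\<alpha>, \<beta>, \<gamma>] =
    (D \<alpha> (Q [\<beta>, \<gamma>]) \<oplus>\<^bsub>P\<^sub>1\<^esub> (\<ominus>\<^bsub>P\<^sub>1\<^esub> D \<beta> (Q [\<alpha>, \<gamma>]) \<oplus>\<^bsub>P\<^sub>1\<^esub> D \<gamma> (Q [\<alpha>, \<beta>]))) \<oplus>\<^bsub>P\<^sub>1\<^esub>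
    (\<ominus>\<^bsub>P\<^sub>1\<^esub> Q [lb \<alpha> \<beta>, \<gamma>] \<oplus>\<^bsub>P\<^sub>1\<^esub> (Q [lb \<alpha> \<gamma>, \<beta>] \<oplus>\<^bsub>P\<^sub>1\<^esub> \<ominus>\<^bsub>P\<^sub>1\<^esub> Q [lb \<beta> \<gamma>, \<alpha>]))"
    using \<alpha>\<beta> by (simp add: coboundary_def index_pairs_2 atMost_2 alt_sign_def nths_Cons D lb Q)
  then show ?thesis
    using \<alpha>\<beta> by (simp add: D lb Q a_minus_def a_ac)
qed

text \<open>Translates a cochain on lists of length two into a two-argument map; linearity is read
  off in the second slot and transferred by skew-symmetry.\<close>

lemma cochains_2_bilinear:
  assumes "module P\<^sub>0 \<Omega>" "module P\<^sub>0 P\<^sub>1" "Q \<in> cochains P\<^sub>0 \<Omega> P\<^sub>1 br\<^sub>1 2"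
  shows "(\<lambda>\<alpha> \<beta>. Q [\<alpha>, \<beta>]) \<in> bilinear_maps P\<^sub>0 \<Omega> \<Omega> P\<^sub>1"
    and "skew_symmetric_on (carrier \<Omega>) P\<^sub>1 (\<lambda>\<alpha> \<beta>. Q [\<alpha>, \<beta>])"
    and "\<alpha> \<in> carrier \<Omega> \<Longrightarrow> \<beta> \<in> carrier \<Omega> \<Longrightarrow> Q [\<alpha>, \<beta>] \<in> bracket_center P\<^sub>1 br\<^sub>1"
proof -
  note Q = assms(3)[unfolded cochains_def]
  have t: "[\<alpha>, \<beta>] \<in> tuples \<Omega> 2" if "\<alpha> \<in> carrier \<Omega>" "\<beta> \<in> carrier \<Omega>" for \<alpha> \<beta>
    using that by (simp add: tuples_def)
  show "Q [\<alpha>, \<beta>] \<in> bracket_center P\<^sub>1 br\<^sub>1" if "\<alpha> \<in> carrier \<Omega>" "\<beta> \<in> carrier \<Omega>" for \<alpha> \<beta>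
    using Q t[OF that] by blast
  show skew: "skew_symmetric_on (carrier \<Omega>) P\<^sub>1 (\<lambda>\<alpha> \<beta>. Q [\<alpha>, \<beta>])"
    unfolding skew_symmetric_on_def
  proof (intro ballI)
    fix \<alpha> \<beta> assume "\<alpha> \<in> carrier \<Omega>" "\<beta> \<in> carrier \<Omega>"
    \<comment> \<open>The exchange rule is used on the reversed list, whose exchanged form is the
      list wanted on the left.\<close>
    then have all: "\<forall>j<2. \<forall>i<j. Q ([\<beta>, \<alpha>][i := [\<beta>, \<alpha>] ! j, j := [\<beta>, \<alpha>] ! i]) = \<ominus>\<^bsub>P\<^sub>1\<^esub> Q [\<beta>, \<alpha>]"
      using Q t[of \<beta> \<alpha>] by blast
    have "Q ([\<beta>, \<alpha>][0 := [\<beta>, \<alpha>] ! 1, 1 := [\<beta>, \<alpha>] ! 0]) = \<ominus>\<^bsub>P\<^sub>1\<^esub> Q [\<beta>, \<alpha>]"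
      by (rule all[THEN spec, THEN mp, THEN spec, THEN mp]) simp_all
    moreover have "[\<beta>, \<alpha>][0 := [\<beta>, \<alpha>] ! 1, 1 := [\<beta>, \<alpha>] ! 0] = [\<alpha>, \<beta>]"
      by simp
    ultimately show "Q [\<alpha>, \<beta>] = \<ominus>\<^bsub>P\<^sub>1\<^esub> Q [\<beta>, \<alpha>]"
      by (simp only:)
  qed
  have "(\<lambda>\<beta>. Q [\<alpha>, \<beta>]) \<in> linear_maps P\<^sub>0 \<Omega> P\<^sub>1" if "\<alpha> \<in> carrier \<Omega>" for \<alpha>
  proof -
    \<comment> \<open>Multilinearity is phrased by updating a given tuple. The second \<alpha> is a
      filler, overwritten by the update at position 1.\<close>
    have all: "\<forall>i<2. (\<lambda>\<beta>. Q ([\<alpha>, \<alpha>][i := \<beta>])) \<in> linear_maps P\<^sub>0 \<Omega> P\<^sub>1"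
      using Q t[OF that that] by blast
    have "(\<lambda>\<beta>. Q ([\<alpha>, \<alpha>][1 := \<beta>])) \<in> linear_maps P\<^sub>0 \<Omega> P\<^sub>1"
      by (rule all[THEN spec, THEN mp]) simp
    then show ?thesis by simp
  qed
  then show "(\<lambda>\<alpha> \<beta>. Q [\<alpha>, \<beta>]) \<in> bilinear_maps P\<^sub>0 \<Omega> \<Omega> P\<^sub>1"
    by (rule bilinear_mapsI_skew[OF assms(1,2) _ skew])
qed

section \<open>Perturbing the Poisson bracket by a central 2-cocycle\<close>

context admissible_poisson_triple
begin

text \<open>Skew-symmetry turns the alternating sum of the coboundary into a cyclic one. Each
  negative term absorbs its sign in one exchange; the positive term
  \<open>Q [lb \<alpha> \<gamma>, \<beta>]\<close> needs two, one in \<open>Q\<close> and one in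
  \<open>lb\<close>.\<close>

lemma cocycle_identity:
  assumes Q: "Q \<in> cocycles P\<^sub>0 \<Omega> lb P\<^sub>1 br\<^sub>1 D 2"
    and abc: "\<alpha> \<in> carrier \<Omega>" "\<beta> \<in> carrier \<Omega>" "\<gamma> \<in> carrier \<Omega>"
  shows "(D \<alpha> (Q [\<beta>, \<gamma>]) \<oplus>\<^bsub>P\<^sub>1\<^esub> Q [\<alpha>, lb \<beta> \<gamma>]) \<oplus>\<^bsub>P\<^sub>1\<^esub>
    (D \<beta> (Q [\<gamma>, \<alpha>]) \<oplus>\<^bsub>P\<^sub>1\<^esub> Q [\<beta>, lb \<gamma> \<alpha>]) \<oplus>\<^bsub>P\<^sub>1\<^esub>
    (D \<gamma> (Q [\<alpha>, \<beta>]) \<oplus>\<^bsub>P\<^sub>1\<^esub> Q [\<gamma>, lb \<alpha> \<beta>]) = \<zero>\<^bsub>P\<^sub>1\<^esub>"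
proof -
  have Q2: "Q \<in> cochains P\<^sub>0 \<Omega> P\<^sub>1 br\<^sub>1 2" using Q by (simp add: cocycles_def)
  note bil = cochains_2_bilinear[OF Om.module_axioms module_P1 Q2]
  have cl: "Q [\<alpha>, \<beta>] \<in> carrier P\<^sub>1" if "\<alpha> \<in> carrier \<Omega>" "\<beta> \<in> carrier \<Omega>" for \<alpha> \<beta>
    using bil(3)[OF that] by (rule center_closed)
  have skew: "Q [\<alpha>, \<beta>] = \<ominus>\<^bsub>P\<^sub>1\<^esub> Q [\<beta>, \<alpha>]" if "\<alpha> \<in> carrier \<Omega>" "\<beta> \<in> carrier \<Omega>" for \<alpha> \<beta>
    using bil(2) that unfolding skew_symmetric_on_def by blast
  have lin: "(\<lambda>\<alpha>. Q [\<alpha>, \<beta>]) \<in> linear_maps P\<^sub>0 \<Omega> P\<^sub>1" if "\<beta> \<in> carrier \<Omega>" for \<beta>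
    using bil(1) that by (simp add: bilinear_maps_def)
  have "D \<beta> (Q [\<gamma>, \<alpha>]) = \<ominus>\<^bsub>P\<^sub>1\<^esub> D \<beta> (Q [\<alpha>, \<gamma>])"
    using abc by (simp add: skew[of \<gamma> \<alpha>] D_uminus_right cl)
  moreover have "Q [\<beta>, lb \<gamma> \<alpha>] = Q [lb \<alpha> \<gamma>, \<beta>]"
  proof -
    have "Q [\<beta>, lb \<gamma> \<alpha>] = \<ominus>\<^bsub>P\<^sub>1\<^esub> Q [lb \<gamma> \<alpha>, \<beta>]" using abc by (intro skew) simp_all
    also have "Q [lb \<gamma> \<alpha>, \<beta>] = \<ominus>\<^bsub>P\<^sub>1\<^esub> Q [lb \<alpha> \<gamma>, \<beta>]"
      using abc linear_maps_uminus[OF lin Om.M.abelian_group_axioms P1.M.abelian_group_axioms]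
      by (simp add: lb_skew[of \<gamma> \<alpha>])
    finally show ?thesis using abc by (simp add: cl)
  qed
  moreover have "Q [\<alpha>, lb \<beta> \<gamma>] = \<ominus>\<^bsub>P\<^sub>1\<^esub> Q [lb \<beta> \<gamma>, \<alpha>]" "Q [\<gamma>, lb \<alpha> \<beta>] = \<ominus>\<^bsub>P\<^sub>1\<^esub> Q [lb \<alpha> \<beta>, \<gamma>]"
    using abc by (simp_all add: skew[of \<alpha> "lb \<beta> \<gamma>"] skew[of \<gamma> "lb \<alpha> \<beta>"])
  moreover have "coboundary \<Omega> lb P\<^sub>1 D 2 Q [\<alpha>, \<beta>, \<gamma>] = \<zero>\<^bsub>P\<^sub>1\<^esub>"
    using Q abc by (simp add: cocycles_def cochain_module_def tuples_def)
  ultimately show ?thesis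
    using abc by (simp add: coboundary_2 P1.M.abelian_group_axioms cl a_minus_def P1.M.a_ac)
qed

text \<open>The deformed bracket with a two-argument map in place of the scaled list cochain, so
  that the Jacobi and gauge calculations involve neither lists nor \<open>t\<close>.\<close>

definition perturbed_bracket ::
  "(('a \<Rightarrow> 'a) set \<Rightarrow> ('a \<Rightarrow> 'a) set \<Rightarrow> 'm) \<Rightarrow> 'a \<times> 'm \<Rightarrow> 'a \<times> 'm \<Rightarrow> 'a \<times> 'm" where
  "perturbed_bracket c = (\<lambda>x y. br x y \<oplus>\<^bsub>P\<^esub> (\<zero>\<^bsub>P\<^sub>0\<^esub>, c (d (fst x)) (d (fst y))))"

text \<open>With second argument (0, \<zeta>) the terms of the triple that contain
  \<open>d 0\<close> vanish, and the bracket on \<open>P\<^sub>1\<close> vanishes by centrality.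
  Only \<open>D\<close> survives, whatever \<eta> is.\<close>

lemma br_center:
  assumes "f \<in> carrier P\<^sub>0" "\<eta> \<in> carrier P\<^sub>1" "\<zeta> \<in> Z"
  shows "br (f, \<eta>) (\<zero>\<^bsub>P\<^sub>0\<^esub>, \<zeta>) = (\<zero>\<^bsub>P\<^sub>0\<^esub>, D (d f) \<zeta>)"
proof -
  have K0: "\<K> (d f) \<zero>\<^bsub>\<Omega>\<^esub> = \<zero>\<^bsub>P\<^sub>1\<^esub>"
    using linear_maps_zero[OF _ Om.M.abelian_group_axioms P1.M.abelian_group_axioms, of "\<K> (d f)" P\<^sub>0]
      K_bilinear assms by (simp add: bilinear_maps_def)
  have br00: "br\<^sub>0 f \<zero>\<^bsub>P\<^sub>0\<^esub> = \<zero>\<^bsub>P\<^sub>0\<^esub>"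
    using linear_maps_zero[OF _ P0.M.abelian_group_axioms P0.M.abelian_group_axioms, of "br\<^sub>0 f" R]
      poisson assms by (simp add: poisson_algebra_def derivations_def)
  show ?thesis
    using assms by (simp add: br_eq center_closed K0 br00 br1_center a_minus_def)
qed

text \<open>The mixed terms of the Jacobiator are \<open>D (d f)\<close> applied to
  \<open>c\<close>, by \<open>br_center\<close>, and \<open>c\<close> applied to
  \<open>d {g, h}\<close>, which is \<open>lb (d g) (d h)\<close>. They add up to the cocycle
  identity on exact differentials. The added term has first component zero, so the bracket stays
  admissible.\<close>

lemma admissible_perturbed_bracket:
  assumes c: "c \<in> bilinear_maps P\<^sub>0 \<Omega> \<Omega> P\<^sub>1" "skew_symmetric_on (carrier \<Omega>) P\<^sub>1 c"
    and cZ: "\<And>\<alpha> \<beta>. \<alpha> \<in> carrier \<Omega> \<Longrightarrow> \<beta> \<in> carrier \<Omega> \<Longrightarrow> c \<alpha> \<beta> \<in> Z"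
    and cocycle: "\<And>\<alpha> \<beta> \<gamma>. \<alpha> \<in> carrier \<Omega> \<Longrightarrow> \<beta> \<in> carrier \<Omega> \<Longrightarrow> \<gamma> \<in> carrier \<Omega> \<Longrightarrow>
      (D \<alpha> (c \<beta> \<gamma>) \<oplus>\<^bsub>P\<^sub>1\<^esub> c \<alpha> (lb \<beta> \<gamma>)) \<oplus>\<^bsub>P\<^sub>1\<^esub> (D \<beta> (c \<gamma> \<alpha>) \<oplus>\<^bsub>P\<^sub>1\<^esub> c \<beta> (lb \<gamma> \<alpha>)) \<oplus>\<^bsub>P\<^sub>1\<^esub>
      (D \<gamma> (c \<alpha> \<beta>) \<oplus>\<^bsub>P\<^sub>1\<^esub> c \<gamma> (lb \<alpha> \<beta>)) = \<zero>\<^bsub>P\<^sub>1\<^esub>"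
  shows "admissible_poisson R P\<^sub>0 br\<^sub>0 P\<^sub>1 (perturbed_bracket c)"
proof -
  let ?c = "\<lambda>x y. (\<zero>\<^bsub>P\<^sub>0\<^esub>, c (d (fst x)) (d (fst y)))"
  have cl: "c \<alpha> \<beta> \<in> carrier P\<^sub>1" if "\<alpha> \<in> carrier \<Omega>" "\<beta> \<in> carrier \<Omega>" for \<alpha> \<beta>
    using cZ[OF that] by (rule center_closed)
  have l: "c \<alpha> \<in> linear_maps P\<^sub>0 \<Omega> P\<^sub>1" "(\<lambda>\<beta>. c \<beta> \<alpha>) \<in> linear_maps P\<^sub>0 \<Omega> P\<^sub>1" if "\<alpha> \<in> carrier \<Omega>" for \<alpha>
    using c(1) that by (simp_all add: bilinear_maps_def)
  note ladd = l[THEN linear_maps_add] and lsm = l[THEN linear_maps_smult]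
  have lin: "?c x \<in> linear_maps R P P" "(\<lambda>y. ?c y x) \<in> linear_maps R P P" if "x \<in> carrier P" for x
    using that by (auto intro!: linear_mapsI simp: d_add d_smult ladd lsm cl)
  have bil: "?c \<in> bilinear_maps R P P P"
    using lin unfolding bilinear_maps_def by blast
  have inv: "\<ominus>\<^bsub>P\<^esub> (\<zero>\<^bsub>P\<^sub>0\<^esub>, \<eta>) = (\<zero>\<^bsub>P\<^sub>0\<^esub>, \<ominus>\<^bsub>P\<^sub>1\<^esub> \<eta>)" if "\<eta> \<in> carrier P\<^sub>1" for \<eta>
    using that by (intro P.M.minus_equality) (simp_all add: P1.M.l_neg)
  have skew: "skew_symmetric_on (carrier P) P ?c"
    unfolding skew_symmetric_on_def
  proof (intro ballI)
    fix x y assume xy: "x \<in> carrier P" "y \<in> carrier P"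
    then have "c (d (fst x)) (d (fst y)) = \<ominus>\<^bsub>P\<^sub>1\<^esub> c (d (fst y)) (d (fst x))"
      using c(2) unfolding skew_symmetric_on_def by (metis d_closed mem_Times_iff semidirect_simps(1))
    then show "?c x y = \<ominus>\<^bsub>P\<^esub> ?c y x"
      using xy by (auto simp: inv cl)
  qed
  \<comment> \<open>The Leibniz rule of \<open>d\<close> splits \<open>c\<close> on a product, and
    multiplying an element with first component zero amounts to scaling it by the first component of
    the other factor.\<close>
  have der: "?c x \<in> derivations R P" "(\<lambda>y. ?c y x) \<in> derivations R P" if "x \<in> carrier P" for x
    using that lin[OF that] by (auto simp: derivations_def d_mult ladd lsm cl P1.M.a_comm)
  have br_c: "br x (?c y z) = (\<zero>\<^bsub>P\<^sub>0\<^esub>, D (d (fst x)) (c (d (fst y)) (d (fst z))))"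
    if "x \<in> carrier P" "y \<in> carrier P" "z \<in> carrier P" for x y z
    using that by (auto simp: br_center cZ)
  have c_br: "?c x (br y z) = (\<zero>\<^bsub>P\<^sub>0\<^esub>, c (d (fst x)) (lb (d (fst y)) (d (fst z))))"
    if "x \<in> carrier P" "y \<in> carrier P" "z \<in> carrier P" for x y z
    using that by (auto simp: fst_br lb_d)
  have c0: "c (d f) \<zero>\<^bsub>\<Omega>\<^esub> = \<zero>\<^bsub>P\<^sub>1\<^esub>" if "f \<in> carrier P\<^sub>0" for f
    using linear_maps_zero[OF l(1) Om.M.abelian_group_axioms P1.M.abelian_group_axioms] that by simp
  have "lie_bracket R P (perturbed_bracket c)"
    unfolding perturbed_bracket_def
  proof (rule lie_bracket_perturb[OF P.module lie_bracket_br bil skew])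
    \<comment> \<open>The inner value has first component zero and \<open>d 0 = 0\<close>, so the
      outer \<open>c\<close> is evaluated at zero.\<close>
    show "?c x (?c y z) = \<zero>\<^bsub>P\<^esub>" if "x \<in> carrier P" for x y z
      using that by (auto simp: c0)
    show "(br x (?c y z) \<oplus>\<^bsub>P\<^esub> ?c x (br y z)) \<oplus>\<^bsub>P\<^esub> (br y (?c z x) \<oplus>\<^bsub>P\<^esub> ?c y (br z x)) \<oplus>\<^bsub>P\<^esub>
        (br z (?c x y) \<oplus>\<^bsub>P\<^esub> ?c z (br x y)) = \<zero>\<^bsub>P\<^esub>"
      if "x \<in> carrier P" "y \<in> carrier P" "z \<in> carrier P" for x y z
      unfolding br_c[OF that] br_c[OF that(2,3,1)] br_c[OF that(3,1,2)]
        c_br[OF that] c_br[OF that(2,3,1)] c_br[OF that(3,1,2)]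
      using that cocycle[of "d (fst x)" "d (fst y)" "d (fst z)"] by auto
  qed
  then have "poisson_algebra R P (perturbed_bracket c)"
    using der br_derivation
    by (auto simp: poisson_algebra_def algebra_P perturbed_bracket_def intro!: derivations_pointwise_add)
  moreover have "fst (perturbed_bracket c x y) = br\<^sub>0 (fst x) (fst y)"
    if xy: "x \<in> carrier P" "y \<in> carrier P" for x y
  proof -
    obtain a b where "br x y = (a, b)" "a \<in> carrier P\<^sub>0"
      using br_closed[OF xy] by auto
    then show ?thesis using fst_br[OF xy] by (simp add: perturbed_bracket_def)
  qed
  ultimately show ?thesis by (simp add: admissible_poisson_def)
qed

text \<open>The coboundary formula in degree one. It is stated for arbitrary functions on \<Omega>,
  because in the gauge problem \<mu> is not known to be central beforehand.\<close>

definition differential :: "(('a \<Rightarrow> 'a) set \<Rightarrow> 'm) \<Rightarrow> ('a \<Rightarrow> 'a) set \<Rightarrow> ('a \<Rightarrow> 'a) set \<Rightarrow> 'm" where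
  "differential \<mu> \<alpha> \<beta> = D \<alpha> (\<mu> \<beta>) \<ominus>\<^bsub>P\<^sub>1\<^esub> D \<beta> (\<mu> \<alpha>) \<ominus>\<^bsub>P\<^sub>1\<^esub> \<mu> (lb \<alpha> \<beta>)"

text \<open>Replacing \<beta> by \<open>f \<beta>\<close> creates the term
  \<open>\<rho> \<alpha> f\<close> times \<open>\<mu> \<beta>\<close> twice: from the Leibniz rule
  of \<open>D\<close> and, with opposite sign, from that of \<open>lb\<close>. The two cancel, and
  skew-symmetry settles the other slot.\<close>

lemma differential_bilinear:
  assumes \<mu>: "\<mu> \<in> linear_maps P\<^sub>0 \<Omega> P\<^sub>1"
  shows "differential \<mu> \<in> bilinear_maps P\<^sub>0 \<Omega> \<Omega> P\<^sub>1"
proof (rule bilinear_mapsI_skew[OF Om.module_axioms module_P1])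
  note cl [simp] = linear_maps_closed[OF \<mu>]
  note \<mu>_simps = linear_maps_add[OF \<mu>] linear_maps_smult[OF \<mu>]
  show "differential \<mu> \<alpha> \<in> linear_maps P\<^sub>0 \<Omega> P\<^sub>1" if \<alpha>: "\<alpha> \<in> carrier \<Omega>" for \<alpha>
  proof (rule linear_mapsI)
    fix \<beta> \<gamma> assume "\<beta> \<in> carrier \<Omega>" "\<gamma> \<in> carrier \<Omega>"
    with \<alpha> show "differential \<mu> \<alpha> (\<beta> \<oplus>\<^bsub>\<Omega>\<^esub> \<gamma>) = differential \<mu> \<alpha> \<beta> \<oplus>\<^bsub>P\<^sub>1\<^esub> differential \<mu> \<alpha> \<gamma>"
      by (simp add: differential_def \<mu>_simps D_add_left D_add_right lb_add_right a_minus_def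
          P1.M.minus_add P1.M.a_ac)
  next
    fix f \<beta> assume f: "f \<in> carrier P\<^sub>0" and \<beta>: "\<beta> \<in> carrier \<Omega>"
    \<comment> \<open>The element \<open>s\<close> stands for the anchor term
      \<open>\<rho> \<alpha> f\<close> times \<open>\<mu> \<beta>\<close>.\<close>
    have cancel: "x \<oplus>\<^bsub>P\<^sub>1\<^esub> s \<ominus>\<^bsub>P\<^sub>1\<^esub> y \<ominus>\<^bsub>P\<^sub>1\<^esub> (z \<oplus>\<^bsub>P\<^sub>1\<^esub> s) = x \<ominus>\<^bsub>P\<^sub>1\<^esub> y \<ominus>\<^bsub>P\<^sub>1\<^esub> z"
      if "x \<in> carrier P\<^sub>1" "s \<in> carrier P\<^sub>1" "y \<in> carrier P\<^sub>1" "z \<in> carrier P\<^sub>1" for x s y z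
    proof -
      have "x \<oplus>\<^bsub>P\<^sub>1\<^esub> s \<ominus>\<^bsub>P\<^sub>1\<^esub> y \<ominus>\<^bsub>P\<^sub>1\<^esub> (z \<oplus>\<^bsub>P\<^sub>1\<^esub> s) =
          (s \<oplus>\<^bsub>P\<^sub>1\<^esub> \<ominus>\<^bsub>P\<^sub>1\<^esub> s) \<oplus>\<^bsub>P\<^sub>1\<^esub> (x \<ominus>\<^bsub>P\<^sub>1\<^esub> y \<ominus>\<^bsub>P\<^sub>1\<^esub> z)"
        using that by (simp add: a_minus_def P1.M.minus_add P1.M.a_ac)
      then show ?thesis using that by (simp add: P1.M.r_neg)
    qed
    have "differential \<mu> \<alpha> (f \<odot>\<^bsub>\<Omega>\<^esub> \<beta>) =
        f \<odot>\<^bsub>P\<^sub>1\<^esub> D \<alpha> (\<mu> \<beta>) \<oplus>\<^bsub>P\<^sub>1\<^esub> \<rho> \<alpha> f \<odot>\<^bsub>P\<^sub>1\<^esub> \<mu> \<beta> \<ominus>\<^bsub>P\<^sub>1\<^esub> f \<odot>\<^bsub>P\<^sub>1\<^esub> D \<beta> (\<mu> \<alpha>) \<ominus>\<^bsub>P\<^sub>1\<^esub>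
        (f \<odot>\<^bsub>P\<^sub>1\<^esub> \<mu> (lb \<alpha> \<beta>) \<oplus>\<^bsub>P\<^sub>1\<^esub> \<rho> \<alpha> f \<odot>\<^bsub>P\<^sub>1\<^esub> \<mu> \<beta>)"
      using \<alpha> \<beta> f by (simp add: differential_def \<mu>_simps D_smult_left D_leibniz lb_leibniz)
    also have "\<dots> = f \<odot>\<^bsub>P\<^sub>1\<^esub> D \<alpha> (\<mu> \<beta>) \<ominus>\<^bsub>P\<^sub>1\<^esub> f \<odot>\<^bsub>P\<^sub>1\<^esub> D \<beta> (\<mu> \<alpha>) \<ominus>\<^bsub>P\<^sub>1\<^esub> f \<odot>\<^bsub>P\<^sub>1\<^esub> \<mu> (lb \<alpha> \<beta>)"
      using \<alpha> \<beta> f by (intro cancel) simp_all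
    also have "\<dots> = f \<odot>\<^bsub>P\<^sub>1\<^esub> differential \<mu> \<alpha> \<beta>"
      using \<alpha> \<beta> f by (simp add: differential_def a_minus_def P1.smult_r_distr P1.smult_r_minus)
    finally show "differential \<mu> \<alpha> (f \<odot>\<^bsub>\<Omega>\<^esub> \<beta>) = f \<odot>\<^bsub>P\<^sub>1\<^esub> differential \<mu> \<alpha> \<beta>" .
  qed (use \<alpha> in \<open>simp add: differential_def\<close>)
  show "skew_symmetric_on (carrier \<Omega>) P\<^sub>1 (differential \<mu>)"
    unfolding skew_symmetric_on_def
  proof (intro ballI)
    fix \<alpha> \<beta> assume *: "\<alpha> \<in> carrier \<Omega>" "\<beta> \<in> carrier \<Omega>"
    then have "\<mu> (lb \<alpha> \<beta>) = \<ominus>\<^bsub>P\<^sub>1\<^esub> \<mu> (lb \<beta> \<alpha>)"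
      using linear_maps_uminus[OF \<mu> Om.M.abelian_group_axioms P1.M.abelian_group_axioms]
      by (simp add: lb_skew[of \<alpha> \<beta>])
    with * show "differential \<mu> \<alpha> \<beta> = \<ominus>\<^bsub>P\<^sub>1\<^esub> differential \<mu> \<beta> \<alpha>"
      by (simp add: differential_def a_minus_def P1.M.minus_add P1.M.a_ac)
  qed
qed

text \<open>The one-variable statement is used twice: in the second slot with an exact first
  argument, and in the first slot with \<beta> fixed.\<close>

lemma bilinear_maps_kahler_eqI:
  assumes b: "b \<in> bilinear_maps P\<^sub>0 \<Omega> \<Omega> P\<^sub>1" and c: "c \<in> bilinear_maps P\<^sub>0 \<Omega> \<Omega> P\<^sub>1"
    and eq: "\<And>f g. f \<in> carrier P\<^sub>0 \<Longrightarrow> g \<in> carrier P\<^sub>0 \<Longrightarrow> b (d f) (d g) = c (d f) (d g)"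
    and \<alpha>: "\<alpha> \<in> carrier \<Omega>" and \<beta>: "\<beta> \<in> carrier \<Omega>"
  shows "b \<alpha> \<beta> = c \<alpha> \<beta>"
proof -
  note kahler_eqI = linear_maps_kahler_eqI[OF algebra_P0 _ _ P1.M.abelian_group_axioms]
  have lin: "u \<gamma> \<in> linear_maps P\<^sub>0 \<Omega> P\<^sub>1" "(\<lambda>\<alpha>. u \<alpha> \<gamma>) \<in> linear_maps P\<^sub>0 \<Omega> P\<^sub>1"
    if "u \<in> bilinear_maps P\<^sub>0 \<Omega> \<Omega> P\<^sub>1" "\<gamma> \<in> carrier \<Omega>" for u \<gamma>
    using that by (simp_all add: bilinear_maps_def)
  have "b (d f) \<beta> = c (d f) \<beta>" if f: "f \<in> carrier P\<^sub>0" for f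
    by (rule kahler_eqI[OF lin(1)[OF b d_closed[OF f]] lin(1)[OF c d_closed[OF f]] eq[OF f] \<beta>])
  then show ?thesis
    by (rule kahler_eqI[OF lin(2)[OF b \<beta>] lin(2)[OF c \<beta>] _ \<alpha>])
qed

section \<open>Gauge transformations as Poisson isomorphisms\<close>

lemma perturbed_bracket_eq:
  assumes "f \<in> carrier P\<^sub>0" "\<eta> \<in> carrier P\<^sub>1" "g \<in> carrier P\<^sub>0" "\<xi> \<in> carrier P\<^sub>1"
  shows "perturbed_bracket c (f, \<eta>) (g, \<xi>) =
    (br\<^sub>0 f g, D (d f) \<xi> \<ominus>\<^bsub>P\<^sub>1\<^esub> D (d g) \<eta> \<oplus>\<^bsub>P\<^sub>1\<^esub> br\<^sub>1 \<eta> \<xi> \<oplus>\<^bsub>P\<^sub>1\<^esub> \<K> (d f) (d g) \<oplus>\<^bsub>P\<^sub>1\<^esub> c (d f) (d g))"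
  using assms by (simp add: perturbed_bracket_def br_eq)

text \<open>The first component is left unchanged, so the gauge transformation of the negative of
  \<mu> undoes the shift of the second.\<close>

lemma gauge_bij_betw:
  assumes \<mu>: "\<mu> \<in> linear_maps P\<^sub>0 \<Omega> P\<^sub>1"
  shows "bij_betw (gauge R P\<^sub>0 P\<^sub>1 \<mu>) (carrier P) (carrier P)"
proof (rule bij_betwI)
  let ?i = "gauge R P\<^sub>0 P\<^sub>1 (\<lambda>\<alpha>. \<ominus>\<^bsub>P\<^sub>1\<^esub> \<mu> \<alpha>)"
  note cl [simp] = linear_maps_closed[OF \<mu>]
  show "gauge R P\<^sub>0 P\<^sub>1 \<mu> \<in> carrier P \<rightarrow> carrier P" "?i \<in> carrier P \<rightarrow> carrier P"
    by (auto simp: gauge_def)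
  show "?i (gauge R P\<^sub>0 P\<^sub>1 \<mu> x) = x" if "x \<in> carrier P" for x
    using that by (auto simp: gauge_def P1.M.l_neg simp flip: P1.M.a_assoc)
  show "gauge R P\<^sub>0 P\<^sub>1 \<mu> (?i x) = x" if "x \<in> carrier P" for x
    using that by (auto simp: gauge_def P1.M.r_neg simp flip: P1.M.a_assoc)
qed

lemma gauge_linear:
  assumes \<mu>: "\<mu> \<in> linear_maps P\<^sub>0 \<Omega> P\<^sub>1"
  shows "gauge R P\<^sub>0 P\<^sub>1 \<mu> \<in> linear_maps R P P"
  by (rule linear_mapsI)
    (auto simp: gauge_def d_add d_smult linear_maps_closed[OF \<mu>] linear_maps_add[OF \<mu>]
      linear_maps_smult[OF \<mu>] P1.smult_r_distr P1.M.a_ac)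

text \<open>By the Leibniz rule \<open>\<mu> (d (f g)) = f \<mu> (d g) + g \<mu> (d f)\<close>,
  which is how the product of \<open>P\<close> combines second components; a product of two values
  of \<mu> never arises.\<close>

lemma gauge_mult:
  assumes \<mu>: "\<mu> \<in> linear_maps P\<^sub>0 \<Omega> P\<^sub>1" and "x \<in> carrier P" "y \<in> carrier P"
  shows "gauge R P\<^sub>0 P\<^sub>1 \<mu> (x \<otimes>\<^bsub>P\<^esub> y) = gauge R P\<^sub>0 P\<^sub>1 \<mu> x \<otimes>\<^bsub>P\<^esub> gauge R P\<^sub>0 P\<^sub>1 \<mu> y"
  using assms(2,3)
  by (auto simp: gauge_def d_mult linear_maps_closed[OF \<mu>] linear_maps_add[OF \<mu>]
      linear_maps_smult[OF \<mu>] P1.smult_r_distr P1.M.a_ac)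

text \<open>Bijectivity, linearity and multiplicativity hold for every \<mu>, so being a Poisson
  isomorphism reduces to compatibility with the brackets.\<close>

lemma gauge_poisson_iso_iff:
  assumes \<mu>: "\<mu> \<in> linear_maps P\<^sub>0 \<Omega> P\<^sub>1" and c: "c \<in> bilinear_maps P\<^sub>0 \<Omega> \<Omega> P\<^sub>1"
  shows "poisson_iso R P (perturbed_bracket c) P br (gauge R P\<^sub>0 P\<^sub>1 \<mu>) \<longleftrightarrow>
    (\<forall>\<alpha>\<in>carrier \<Omega>. \<mu> \<alpha> \<in> Z) \<and>
    (\<forall>\<alpha>\<in>carrier \<Omega>. \<forall>\<beta>\<in>carrier \<Omega>. c \<alpha> \<beta> = differential \<mu> \<alpha> \<beta>)" (is "?iso \<longleftrightarrow> ?center \<and> ?exact")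
proof -
  note \<mu>cl [simp] = linear_maps_closed[OF \<mu>] and ccl [simp] = bilinear_maps_closed[OF c]
  note ab = Om.M.abelian_group_axioms P1.M.abelian_group_axioms
  note z [simp] = linear_maps_zero[OF \<mu> ab]
  let ?\<phi> = "gauge R P\<^sub>0 P\<^sub>1 \<mu>"
  have b0: "b \<alpha> \<zero>\<^bsub>\<Omega>\<^esub> = \<zero>\<^bsub>P\<^sub>1\<^esub>" if "b \<in> bilinear_maps P\<^sub>0 \<Omega> \<Omega> P\<^sub>1" "\<alpha> \<in> carrier \<Omega>" for b \<alpha>
    using linear_maps_zero[OF _ ab] that by (auto simp: bilinear_maps_def)
  note c0 [simp] = b0[OF c] b0[OF K_bilinear]
  \<comment> \<open>Both first components are \<open>{f, g}\<close>, so only the second ones are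
    compared; \<open>\<mu> (d {f, g})\<close> is written as \<mu> of
    \<open>lb (d f) (d g)\<close>.\<close>
  have bracket_iff: "?\<phi> (perturbed_bracket c (f, \<eta>) (g, \<xi>)) = br (?\<phi> (f, \<eta>)) (?\<phi> (g, \<xi>)) \<longleftrightarrow>
      \<mu> (lb (d f) (d g)) \<oplus>\<^bsub>P\<^sub>1\<^esub> (D (d f) \<xi> \<ominus>\<^bsub>P\<^sub>1\<^esub> D (d g) \<eta> \<oplus>\<^bsub>P\<^sub>1\<^esub> br\<^sub>1 \<eta> \<xi> \<oplus>\<^bsub>P\<^sub>1\<^esub> \<K> (d f) (d g) \<oplus>\<^bsub>P\<^sub>1\<^esub> c (d f) (d g)) =
      D (d f) (\<mu> (d g)) \<oplus>\<^bsub>P\<^sub>1\<^esub> D (d f) \<xi> \<ominus>\<^bsub>P\<^sub>1\<^esub> (D (d g) (\<mu> (d f)) \<oplus>\<^bsub>P\<^sub>1\<^esub> D (d g) \<eta>) \<oplus>\<^bsub>P\<^sub>1\<^esub>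
      br\<^sub>1 (\<mu> (d f) \<oplus>\<^bsub>P\<^sub>1\<^esub> \<eta>) (\<mu> (d g) \<oplus>\<^bsub>P\<^sub>1\<^esub> \<xi>) \<oplus>\<^bsub>P\<^sub>1\<^esub> \<K> (d f) (d g)"
    if "f \<in> carrier P\<^sub>0" "\<eta> \<in> carrier P\<^sub>1" "g \<in> carrier P\<^sub>0" "\<xi> \<in> carrier P\<^sub>1" for f \<eta> g \<xi>
    using that by (simp add: perturbed_bracket_eq br_eq gauge_def D_add_right lb_d)
  show ?thesis
  proof
    assume ?iso
    then have hom: "?\<phi> (perturbed_bracket c (f, \<eta>) (g, \<xi>)) = br (?\<phi> (f, \<eta>)) (?\<phi> (g, \<xi>))"
      if "f \<in> carrier P\<^sub>0" "\<eta> \<in> carrier P\<^sub>1" "g \<in> carrier P\<^sub>0" "\<xi> \<in> carrier P\<^sub>1" for f \<eta> g \<xi>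
      using that by (simp add: poisson_iso_def)
    have dZ: "\<mu> (d f) \<in> Z" if f: "f \<in> carrier P\<^sub>0" for f
    proof -
      have "br\<^sub>1 (\<mu> (d f)) \<xi> = \<zero>\<^bsub>P\<^sub>1\<^esub>" if \<xi>: "\<xi> \<in> carrier P\<^sub>1" for \<xi>
      proof -
        have lb0: "lb (d f) \<zero>\<^bsub>\<Omega>\<^esub> = \<zero>\<^bsub>\<Omega>\<^esub>"
          using linear_maps_zero[of "lb (d f)" R "restrict_scalars P\<^sub>0 \<Omega>" "restrict_scalars P\<^sub>0 \<Omega>"] lb_bilinear f
          by (simp add: bilinear_maps_def)
        have br0: "br\<^sub>1 \<zero>\<^bsub>P\<^sub>1\<^esub> \<xi> = \<zero>\<^bsub>P\<^sub>1\<^esub>" by (rule br1_center) (simp_all add: \<xi>)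
        \<comment> \<open>For the pair (f, 0), (0, \<xi>) every term with \<open>d 0\<close> drops
          out and the shift by \<mu> survives only inside the bracket of
          \<open>P\<^sub>1\<close>.\<close>
        have "D (d f) \<xi> = D (d f) \<xi> \<oplus>\<^bsub>P\<^sub>1\<^esub> br\<^sub>1 (\<mu> (d f)) \<xi>"
          using iffD1[OF bracket_iff hom, OF f P1.M.zero_closed P0.M.zero_closed \<xi> f P1.M.zero_closed P0.M.zero_closed \<xi>] f \<xi>
          by (simp add: lb0 br0 a_minus_def)
        then show ?thesis using f \<xi> by simp
      qed
      then show ?thesis using f by (simp add: bracket_center_def)
    qed
    \<comment> \<open>The center is a submodule, so it contains the values on all combinations of
      exact differentials.\<close>
    have cent: ?center
    proof
      fix \<alpha> assume "\<alpha> \<in> carrier \<Omega>"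
      then show "\<mu> \<alpha> \<in> Z"
        by (induction rule: kahler_induct[OF algebra_P0, consumes 1])
          (simp_all add: linear_maps_add[OF \<mu>] linear_maps_smult[OF \<mu>] dZ)
    qed
    have "c (d f) (d g) = differential \<mu> (d f) (d g)" if f: "f \<in> carrier P\<^sub>0" and g: "g \<in> carrier P\<^sub>0" for f g
    proof -
      let ?m = "\<mu> (lb (d f) (d g))" and ?k = "\<K> (d f) (d g)" and ?c = "c (d f) (d g)"
      let ?x = "D (d f) (\<mu> (d g))" and ?y = "D (d g) (\<mu> (d f))"
      \<comment> \<open>This is the bracket identity at (f, 0), (g, 0); the bracket of
        \<open>P\<^sub>1\<close> vanishes because the values of \<mu> are already known to be
        central.\<close>
      have "?m \<oplus>\<^bsub>P\<^sub>1\<^esub> (?k \<oplus>\<^bsub>P\<^sub>1\<^esub> ?c) = ?x \<ominus>\<^bsub>P\<^sub>1\<^esub> ?y \<oplus>\<^bsub>P\<^sub>1\<^esub> ?k"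
      proof -
        have "D (d f) \<zero>\<^bsub>P\<^sub>1\<^esub> \<ominus>\<^bsub>P\<^sub>1\<^esub> D (d g) \<zero>\<^bsub>P\<^sub>1\<^esub> \<oplus>\<^bsub>P\<^sub>1\<^esub> br\<^sub>1 \<zero>\<^bsub>P\<^sub>1\<^esub> \<zero>\<^bsub>P\<^sub>1\<^esub> \<oplus>\<^bsub>P\<^sub>1\<^esub> ?k \<oplus>\<^bsub>P\<^sub>1\<^esub> ?c = ?k \<oplus>\<^bsub>P\<^sub>1\<^esub> ?c"
          using f g by (simp add: br1_center a_minus_def)
        moreover have "?x \<oplus>\<^bsub>P\<^sub>1\<^esub> D (d f) \<zero>\<^bsub>P\<^sub>1\<^esub> \<ominus>\<^bsub>P\<^sub>1\<^esub> (?y \<oplus>\<^bsub>P\<^sub>1\<^esub> D (d g) \<zero>\<^bsub>P\<^sub>1\<^esub>) \<oplus>\<^bsub>P\<^sub>1\<^esub>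
            br\<^sub>1 (\<mu> (d f) \<oplus>\<^bsub>P\<^sub>1\<^esub> \<zero>\<^bsub>P\<^sub>1\<^esub>) (\<mu> (d g) \<oplus>\<^bsub>P\<^sub>1\<^esub> \<zero>\<^bsub>P\<^sub>1\<^esub>) \<oplus>\<^bsub>P\<^sub>1\<^esub> ?k = ?x \<ominus>\<^bsub>P\<^sub>1\<^esub> ?y \<oplus>\<^bsub>P\<^sub>1\<^esub> ?k"
          using f g by (simp add: br1_center dZ)
        ultimately show ?thesis
          using iffD1[OF bracket_iff hom, OF f P1.M.zero_closed g P1.M.zero_closed f P1.M.zero_closed g P1.M.zero_closed]
          by (simp only:)
      qed
      then have "?k \<oplus>\<^bsub>P\<^sub>1\<^esub> (?c \<oplus>\<^bsub>P\<^sub>1\<^esub> ?m) = ?k \<oplus>\<^bsub>P\<^sub>1\<^esub> (?x \<ominus>\<^bsub>P\<^sub>1\<^esub> ?y)"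
        using f g by (simp add: a_minus_def P1.M.a_ac)
      then have "?c \<oplus>\<^bsub>P\<^sub>1\<^esub> ?m = ?x \<ominus>\<^bsub>P\<^sub>1\<^esub> ?y"
        using f g by simp
      then have "?c = (?x \<ominus>\<^bsub>P\<^sub>1\<^esub> ?y) \<oplus>\<^bsub>P\<^sub>1\<^esub> \<ominus>\<^bsub>P\<^sub>1\<^esub> ?m"
        using f g by (intro P1.M.add.inv_solve_right[THEN iffD2]) simp_all
      then show ?thesis
        by (simp only: differential_def a_minus_def)
    qed
    with bilinear_maps_kahler_eqI[OF c differential_bilinear[OF \<mu>]] have ?exact by blast
    with cent show "?center \<and> ?exact" by blast
  next
    assume *: "?center \<and> ?exact"
    have "?\<phi> (perturbed_bracket c (f, \<eta>) (g, \<xi>)) = br (?\<phi> (f, \<eta>)) (?\<phi> (g, \<xi>))"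
      if fg: "f \<in> carrier P\<^sub>0" "\<eta> \<in> carrier P\<^sub>1" "g \<in> carrier P\<^sub>0" "\<xi> \<in> carrier P\<^sub>1" for f \<eta> g \<xi>
    proof -
      have b: "br\<^sub>1 (\<mu> (d f) \<oplus>\<^bsub>P\<^sub>1\<^esub> \<eta>) (\<mu> (d g) \<oplus>\<^bsub>P\<^sub>1\<^esub> \<xi>) = br\<^sub>1 \<eta> \<xi>"
        using * fg by (simp add: br1_add br1_center)
      let ?m = "\<mu> (lb (d f) (d g))"
      let ?s = "D (d f) (\<mu> (d g)) \<oplus>\<^bsub>P\<^sub>1\<^esub> D (d f) \<xi> \<ominus>\<^bsub>P\<^sub>1\<^esub> (D (d g) (\<mu> (d f)) \<oplus>\<^bsub>P\<^sub>1\<^esub> D (d g) \<eta>) \<oplus>\<^bsub>P\<^sub>1\<^esub>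
        br\<^sub>1 \<eta> \<xi> \<oplus>\<^bsub>P\<^sub>1\<^esub> \<K> (d f) (d g)"
      \<comment> \<open>Inserting the differential for \<open>c\<close> brings in the negative of
        \<open>?m\<close>, and its other two terms are the ones that the gauge shift adds under
        \<open>D\<close>.\<close>
      have "?m \<oplus>\<^bsub>P\<^sub>1\<^esub> (D (d f) \<xi> \<ominus>\<^bsub>P\<^sub>1\<^esub> D (d g) \<eta> \<oplus>\<^bsub>P\<^sub>1\<^esub> br\<^sub>1 \<eta> \<xi> \<oplus>\<^bsub>P\<^sub>1\<^esub> \<K> (d f) (d g) \<oplus>\<^bsub>P\<^sub>1\<^esub> c (d f) (d g)) =
          (?m \<oplus>\<^bsub>P\<^sub>1\<^esub> \<ominus>\<^bsub>P\<^sub>1\<^esub> ?m) \<oplus>\<^bsub>P\<^sub>1\<^esub> ?s"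
        using * fg by (simp add: differential_def a_minus_def P1.M.minus_add P1.M.a_ac)
      also have "\<dots> = ?s"
        using fg by (simp add: P1.M.r_neg)
      finally show ?thesis
        by (simp only: bracket_iff[OF fg] b)
    qed
    then show ?iso
      using gauge_bij_betw[OF \<mu>] gauge_linear[OF \<mu>] gauge_mult[OF \<mu>]
      by (auto simp: poisson_iso_def simp del: semidirect_simps(2-5))
  qed
qed

end

section \<open>Coboundaries and cohomology classes\<close>

text \<open>As linearity of a cochain is phrased by updating a tuple, an element \<alpha> must be at
  hand to form one, in the second claim too.\<close>

lemma cochains_1_linear:
  assumes "Q \<in> cochains P\<^sub>0 \<Omega> P\<^sub>1 br\<^sub>1 (Suc 0)"
  shows "\<alpha> \<in> carrier \<Omega> \<Longrightarrow> Q [\<alpha>] \<in> bracket_center P\<^sub>1 br\<^sub>1"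
    and "\<alpha> \<in> carrier \<Omega> \<Longrightarrow> (\<lambda>\<alpha>. Q [\<alpha>]) \<in> linear_maps P\<^sub>0 \<Omega> P\<^sub>1"
proof -
  show "Q [\<alpha>] \<in> bracket_center P\<^sub>1 br\<^sub>1" if "\<alpha> \<in> carrier \<Omega>"
    using assms that unfolding cochains_def by (auto simp: tuples_1)
  show "(\<lambda>\<alpha>. Q [\<alpha>]) \<in> linear_maps P\<^sub>0 \<Omega> P\<^sub>1" if "\<alpha> \<in> carrier \<Omega>"
  proof -
    have "[\<alpha>] \<in> tuples \<Omega> (Suc 0)" using that by (simp add: tuples_1)
    then have all: "\<forall>i<Suc 0. (\<lambda>\<beta>. Q ([\<alpha>][i := \<beta>])) \<in> linear_maps P\<^sub>0 \<Omega> P\<^sub>1"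
      using assms unfolding cochains_def by blast
    have "(\<lambda>\<beta>. Q ([\<alpha>][0 := \<beta>])) \<in> linear_maps P\<^sub>0 \<Omega> P\<^sub>1"
      by (rule all[THEN spec, THEN mp]) simp
    then show ?thesis by simp
  qed
qed

text \<open>Restriction to tuples makes the function extensional; with a single position there is no
  pair to exchange, so skew-symmetry is vacuous.\<close>

lemma cochains_1I:
  assumes "module P\<^sub>0 \<Omega>" "\<mu> \<in> linear_maps P\<^sub>0 \<Omega> P\<^sub>1" "\<And>\<alpha>. \<alpha> \<in> carrier \<Omega> \<Longrightarrow> \<mu> \<alpha> \<in> bracket_center P\<^sub>1 br\<^sub>1"
  shows "(\<lambda>xs\<in>tuples \<Omega> (Suc 0). \<mu> (hd xs)) \<in> cochains P\<^sub>0 \<Omega> P\<^sub>1 br\<^sub>1 (Suc 0)"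
proof -
  have "(\<lambda>\<alpha>. (\<lambda>xs\<in>tuples \<Omega> (Suc 0). \<mu> (hd xs)) [\<alpha>]) \<in> linear_maps P\<^sub>0 \<Omega> P\<^sub>1"
    by (rule linear_maps_cong[OF assms(2,1)]) (simp add: tuples_1)
  then show ?thesis
    using assms(3) by (auto simp: cochains_def tuples_1 cong: if_cong)
qed

context admissible_poisson_triple
begin

text \<open>One-cochains as plain functions on \<Omega>, not normalised off the carrier. This does
  no harm, as \<open>differential_cochain\<close> depends only on values on the carrier.\<close>

abbreviation central_maps :: "(('a \<Rightarrow> 'a) set \<Rightarrow> 'm) set" where
  "central_maps \<equiv> {\<mu> \<in> linear_maps P\<^sub>0 \<Omega> P\<^sub>1. \<forall>\<alpha>\<in>carrier \<Omega>. \<mu> \<alpha> \<in> Z}"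

definition differential_cochain :: "(('a \<Rightarrow> 'a) set \<Rightarrow> 'm) \<Rightarrow> ('a \<Rightarrow> 'a) set list \<Rightarrow> 'm" where
  "differential_cochain \<mu> = (\<lambda>xs\<in>tuples \<Omega> 2. differential \<mu> (xs ! 0) (xs ! 1))"

lemma coboundary_differential:
  assumes "\<And>\<alpha>. \<alpha> \<in> carrier \<Omega> \<Longrightarrow> Q [\<alpha>] \<in> carrier P\<^sub>1"
  shows "coboundary \<Omega> lb P\<^sub>1 D (Suc 0) Q = differential_cochain (\<lambda>\<alpha>. Q [\<alpha>])"
proof
  fix xs
  show "coboundary \<Omega> lb P\<^sub>1 D (Suc 0) Q xs = differential_cochain (\<lambda>\<alpha>. Q [\<alpha>]) xs"
  proof (cases "xs \<in> tuples \<Omega> 2")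
    case True
    then obtain \<alpha> \<beta> where "\<alpha> \<in> carrier \<Omega>" "\<beta> \<in> carrier \<Omega>" "xs = [\<alpha>, \<beta>]"
      by (auto simp: numeral_2_eq_2 tuples_2)
    with True show ?thesis
      by (simp add: differential_cochain_def differential_def coboundary_1 P1.M.abelian_group_axioms assms)
  next
    case False
    then show ?thesis by (simp add: differential_cochain_def coboundary_def numeral_2_eq_2)
  qed
qed

text \<open>A cochain \<open>Q\<close> gives the central map sending \<alpha> to
  \<open>Q [\<alpha>]\<close>, and a central map gives a cochain by taking the head of the list;
  both passages preserve the coboundary.\<close>

lemma coboundaries_2: "coboundaries P\<^sub>0 \<Omega> lb P\<^sub>1 br\<^sub>1 D 2 = differential_cochain ` central_maps"
proof -
  have "coboundary \<Omega> lb P\<^sub>1 D (Suc 0) ` cochains P\<^sub>0 \<Omega> P\<^sub>1 br\<^sub>1 (Suc 0) = differential_cochain ` central_maps"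
  proof (intro equalityI subsetI)
    fix h assume "h \<in> coboundary \<Omega> lb P\<^sub>1 D (Suc 0) ` cochains P\<^sub>0 \<Omega> P\<^sub>1 br\<^sub>1 (Suc 0)"
    then obtain Q where Q: "Q \<in> cochains P\<^sub>0 \<Omega> P\<^sub>1 br\<^sub>1 (Suc 0)" "h = coboundary \<Omega> lb P\<^sub>1 D (Suc 0) Q"
      by blast
    have "(\<lambda>\<alpha>. Q [\<alpha>]) \<in> central_maps"
      using cochains_1_linear[OF Q(1)] Om.M.zero_closed by blast
    moreover have "h = differential_cochain (\<lambda>\<alpha>. Q [\<alpha>])"
      unfolding Q(2) using cochains_1_linear(1)[OF Q(1)] center_closed
      by (intro coboundary_differential) blast
    ultimately show "h \<in> differential_cochain ` central_maps" by blast
  next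
    fix h assume "h \<in> differential_cochain ` central_maps"
    then obtain \<mu> where \<mu>: "\<mu> \<in> central_maps" "h = differential_cochain \<mu>" by blast
    let ?Q = "\<lambda>xs\<in>tuples \<Omega> (Suc 0). \<mu> (hd xs)"
    have Q: "?Q [\<alpha>] = \<mu> \<alpha>" if "\<alpha> \<in> carrier \<Omega>" for \<alpha>
      using that by (simp add: tuples_1)
    have "coboundary \<Omega> lb P\<^sub>1 D (Suc 0) ?Q = differential_cochain (\<lambda>\<alpha>. ?Q [\<alpha>])"
      using \<mu>(1) by (intro coboundary_differential) (simp add: Q center_closed del: restrict_apply)
    also have "\<dots> = h"
      unfolding \<mu>(2) differential_cochain_def
      by (rule restrict_ext)
        (auto simp: differential_def Q numeral_2_eq_2 tuples_2 simp del: restrict_apply)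
    finally show "h \<in> coboundary \<Omega> lb P\<^sub>1 D (Suc 0) ` cochains P\<^sub>0 \<Omega> P\<^sub>1 br\<^sub>1 (Suc 0)"
      using cochains_1I[OF Om.module_axioms, of \<mu> P\<^sub>1 br\<^sub>1] \<mu>(1) by blast
  qed
  then show ?thesis by (simp add: coboundaries_def numeral_2_eq_2)
qed

lemma differential_add:
  assumes "\<mu> \<in> central_maps" "\<nu> \<in> central_maps"
  shows "(\<lambda>\<alpha>. \<mu> \<alpha> \<oplus>\<^bsub>P\<^sub>1\<^esub> \<nu> \<alpha>) \<in> central_maps"
    and "\<alpha> \<in> carrier \<Omega> \<Longrightarrow> \<beta> \<in> carrier \<Omega> \<Longrightarrow>
      differential (\<lambda>\<alpha>. \<mu> \<alpha> \<oplus>\<^bsub>P\<^sub>1\<^esub> \<nu> \<alpha>) \<alpha> \<beta> = differential \<mu> \<alpha> \<beta> \<oplus>\<^bsub>P\<^sub>1\<^esub> differential \<nu> \<alpha> \<beta>"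
proof -
  show "(\<lambda>\<alpha>. \<mu> \<alpha> \<oplus>\<^bsub>P\<^sub>1\<^esub> \<nu> \<alpha>) \<in> central_maps"
    using assms linear_maps_pointwise_add[OF module_P1] by auto
  have cl: "\<mu> \<alpha> \<in> carrier P\<^sub>1" "\<nu> \<alpha> \<in> carrier P\<^sub>1" if "\<alpha> \<in> carrier \<Omega>" for \<alpha>
    using assms that center_closed by auto
  show "differential (\<lambda>\<alpha>. \<mu> \<alpha> \<oplus>\<^bsub>P\<^sub>1\<^esub> \<nu> \<alpha>) \<alpha> \<beta> = differential \<mu> \<alpha> \<beta> \<oplus>\<^bsub>P\<^sub>1\<^esub> differential \<nu> \<alpha> \<beta>"
    if "\<alpha> \<in> carrier \<Omega>" "\<beta> \<in> carrier \<Omega>"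
    using that by (simp add: differential_def cl D_add_right a_minus_def P1.M.minus_add P1.M.a_ac)
qed

text \<open>A scalar from \<open>R\<close> passes through \<open>D \<alpha>\<close>, which is
  \<open>R\<close>-linear; for a general factor from \<open>P\<^sub>0\<close> the Leibniz rule adds
  an anchor term.\<close>

lemma differential_scalar:
  assumes "\<mu> \<in> central_maps" "r \<in> carrier R"
  shows "(\<lambda>\<alpha>. (r \<odot>\<^bsub>P\<^sub>0\<^esub> \<one>\<^bsub>P\<^sub>0\<^esub>) \<odot>\<^bsub>P\<^sub>1\<^esub> \<mu> \<alpha>) \<in> central_maps"
    and "\<alpha> \<in> carrier \<Omega> \<Longrightarrow> \<beta> \<in> carrier \<Omega> \<Longrightarrow>
      differential (\<lambda>\<alpha>. (r \<odot>\<^bsub>P\<^sub>0\<^esub> \<one>\<^bsub>P\<^sub>0\<^esub>) \<odot>\<^bsub>P\<^sub>1\<^esub> \<mu> \<alpha>) \<alpha> \<beta> = (r \<odot>\<^bsub>P\<^sub>0\<^esub> \<one>\<^bsub>P\<^sub>0\<^esub>) \<odot>\<^bsub>P\<^sub>1\<^esub> differential \<mu> \<alpha> \<beta>"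
proof -
  have cl: "\<mu> \<alpha> \<in> carrier P\<^sub>1" if "\<alpha> \<in> carrier \<Omega>" for \<alpha>
    using assms that center_closed by auto
  have "(\<lambda>\<alpha>. (r \<odot>\<^bsub>P\<^sub>0\<^esub> \<one>\<^bsub>P\<^sub>0\<^esub>) \<odot>\<^bsub>P\<^sub>1\<^esub> \<mu> \<alpha>) \<in> linear_maps P\<^sub>0 \<Omega> P\<^sub>1"
    using assms by (intro linear_maps_pointwise_smult[OF module_P1]) simp_all
  with assms show "(\<lambda>\<alpha>. (r \<odot>\<^bsub>P\<^sub>0\<^esub> \<one>\<^bsub>P\<^sub>0\<^esub>) \<odot>\<^bsub>P\<^sub>1\<^esub> \<mu> \<alpha>) \<in> central_maps" by simp
  show "differential (\<lambda>\<alpha>. (r \<odot>\<^bsub>P\<^sub>0\<^esub> \<one>\<^bsub>P\<^sub>0\<^esub>) \<odot>\<^bsub>P\<^sub>1\<^esub> \<mu> \<alpha>) \<alpha> \<beta> = (r \<odot>\<^bsub>P\<^sub>0\<^esub> \<one>\<^bsub>P\<^sub>0\<^esub>) \<odot>\<^bsub>P\<^sub>1\<^esub> differential \<mu> \<alpha> \<beta>"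
    if "\<alpha> \<in> carrier \<Omega>" "\<beta> \<in> carrier \<Omega>"
    using that assms(2)
    by (simp add: differential_def cl D_scalar a_minus_def P1.smult_r_distr P1.smult_r_minus)
qed

text \<open>A class is a coset of the coboundaries, and that of zero is the set of coboundaries
  itself. Translation by a primitive \<mu> maps this set onto itself, with translation by its
  negative as inverse; conversely \<open>C\<close> belongs to its own coset.\<close>

lemma cohomology_class_trivial_iff:
  assumes C: "C \<in> cochains P\<^sub>0 \<Omega> P\<^sub>1 br\<^sub>1 2"
  shows "cohomology_class P\<^sub>0 \<Omega> lb P\<^sub>1 br\<^sub>1 D 2 C =
      cohomology_class P\<^sub>0 \<Omega> lb P\<^sub>1 br\<^sub>1 D 2 \<zero>\<^bsub>cochain_module P\<^sub>0 \<Omega> P\<^sub>1 br\<^sub>1 2\<^esub> \<longleftrightarrow>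
    (\<exists>\<mu>\<in>central_maps. \<forall>\<alpha>\<in>carrier \<Omega>. \<forall>\<beta>\<in>carrier \<Omega>. C [\<alpha>, \<beta>] = differential \<mu> \<alpha> \<beta>)"
    (is "?class C = ?class ?zero \<longleftrightarrow> ?exact")
proof -
  let ?add = "\<lambda>Q Q' :: ('a \<Rightarrow> 'a) set list \<Rightarrow> 'm. \<lambda>xs\<in>tuples \<Omega> 2. Q xs \<oplus>\<^bsub>P\<^sub>1\<^esub> Q' xs"
  have tup: "xs \<in> tuples \<Omega> 2 \<longleftrightarrow> (\<exists>\<alpha>\<in>carrier \<Omega>. \<exists>\<beta>\<in>carrier \<Omega>. xs = [\<alpha>, \<beta>])" for xs
    by (simp add: numeral_2_eq_2 tuples_2)
  have zero: "?zero = (\<lambda>xs\<in>tuples \<Omega> 2. \<zero>\<^bsub>P\<^sub>1\<^esub>)"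
    by (simp add: cochain_module_def restrict_def)
  have class_eq: "?class Q = {?add (differential_cochain \<mu>) Q |\<mu>. \<mu> \<in> central_maps}" for Q
    unfolding cohomology_class_def coboundaries_2
    by (auto simp: a_r_coset_def' cochain_module_def)
  have C_ext: "C = restrict C (tuples \<Omega> 2)"
    using C by (auto simp: cochains_def extensional_restrict PiE_def)
  have C_cl: "C [\<alpha>, \<beta>] \<in> carrier P\<^sub>1" if "\<alpha> \<in> carrier \<Omega>" "\<beta> \<in> carrier \<Omega>" for \<alpha> \<beta>
    using cochains_2_bilinear(3)[OF Om.module_axioms module_P1 C that] by (rule center_closed)
  have dcl: "differential \<mu> \<alpha> \<beta> \<in> carrier P\<^sub>1"
    if "\<mu> \<in> central_maps" "\<alpha> \<in> carrier \<Omega>" "\<beta> \<in> carrier \<Omega>" for \<mu> \<alpha> \<beta>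
    using bilinear_maps_closed[OF differential_bilinear] that by blast
  have add_zero: "?add (differential_cochain \<mu>) ?zero = differential_cochain \<mu>" if "\<mu> \<in> central_maps" for \<mu>
    unfolding zero differential_cochain_def
    by (rule restrict_ext) (auto simp: tup dcl[OF that])
  have exact_iff: "C = differential_cochain \<mu> \<longleftrightarrow>
      (\<forall>\<alpha>\<in>carrier \<Omega>. \<forall>\<beta>\<in>carrier \<Omega>. C [\<alpha>, \<beta>] = differential \<mu> \<alpha> \<beta>)" for \<mu>
  proof
    assume "C = differential_cochain \<mu>"
    then show "\<forall>\<alpha>\<in>carrier \<Omega>. \<forall>\<beta>\<in>carrier \<Omega>. C [\<alpha>, \<beta>] = differential \<mu> \<alpha> \<beta>"
      by (simp add: differential_cochain_def tup)
  next
    assume "\<forall>\<alpha>\<in>carrier \<Omega>. \<forall>\<beta>\<in>carrier \<Omega>. C [\<alpha>, \<beta>] = differential \<mu> \<alpha> \<beta>"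
    then have "restrict C (tuples \<Omega> 2) = differential_cochain \<mu>"
      unfolding differential_cochain_def by (intro restrict_ext) (auto simp: tup)
    with C_ext show "C = differential_cochain \<mu>" by (rule trans)
  qed
  have zero_central: "(\<lambda>_. \<zero>\<^bsub>P\<^sub>1\<^esub>) \<in> central_maps"
    by (auto intro!: linear_mapsI)
  have add_diff: "?add (differential_cochain \<mu>) (differential_cochain \<nu>) =
      differential_cochain (\<lambda>\<alpha>. \<mu> \<alpha> \<oplus>\<^bsub>P\<^sub>1\<^esub> \<nu> \<alpha>)" if "\<mu> \<in> central_maps" "\<nu> \<in> central_maps" for \<mu> \<nu>
    unfolding differential_cochain_def
    by (rule restrict_ext) (auto simp: tup differential_add(2)[OF that])
  show ?thesis
  proof
    assume eq: "?class C = ?class ?zero"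
    \<comment> \<open>The zero map puts \<open>C\<close> into its own class. The sum is a restricted
      function, so it equals \<open>C\<close> because cochains are extensional.\<close>
    have "?add (differential_cochain (\<lambda>_. \<zero>\<^bsub>P\<^sub>1\<^esub>)) C = restrict C (tuples \<Omega> 2)"
      by (rule restrict_ext)
        (auto simp: tup differential_cochain_def differential_def C_cl a_minus_def)
    then have "C = ?add (differential_cochain (\<lambda>_. \<zero>\<^bsub>P\<^sub>1\<^esub>)) C"
      by (rule trans[OF C_ext sym])
    then have "C \<in> ?class C"
      unfolding class_eq using zero_central by blast
    then have "C \<in> ?class ?zero" by (rule eq[THEN equalityD1, THEN subsetD])
    then obtain \<mu> where \<mu>: "\<mu> \<in> central_maps" "C = ?add (differential_cochain \<mu>) ?zero"
      unfolding class_eq by blast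
    then have "C = differential_cochain \<mu>"
      by (simp only: add_zero)
    with \<mu>(1) exact_iff show ?exact by blast
  next
    assume ?exact
    then obtain \<mu> where \<mu>: "\<mu> \<in> central_maps" "C = differential_cochain \<mu>"
      using exact_iff by blast
    define \<mu>' where "\<mu>' = (\<lambda>\<alpha>. \<ominus>\<^bsub>P\<^sub>1\<^esub> \<mu> \<alpha>)"
    have \<mu>': "\<mu>' \<in> central_maps"
      using \<mu>(1) linear_maps_pointwise_uminus[OF module_P1] by (auto simp: \<mu>'_def)
    have cl: "\<nu> \<alpha> \<in> carrier P\<^sub>1" if "\<nu> \<in> central_maps" "\<alpha> \<in> carrier \<Omega>" for \<nu> \<alpha>
      using that center_closed by blast
    \<comment> \<open>The sum agrees with \<nu> on the carrier but perhaps not elsewhere, so the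
      equality is claimed only after passing to cochains.\<close>
    have shift: "differential_cochain (\<lambda>\<alpha>. \<nu> \<alpha> \<oplus>\<^bsub>P\<^sub>1\<^esub> \<mu>' \<alpha> \<oplus>\<^bsub>P\<^sub>1\<^esub> \<mu> \<alpha>) = differential_cochain \<nu>"
      if "\<nu> \<in> central_maps" for \<nu>
    proof -
      have "\<nu> \<alpha> \<oplus>\<^bsub>P\<^sub>1\<^esub> \<mu>' \<alpha> \<oplus>\<^bsub>P\<^sub>1\<^esub> \<mu> \<alpha> = \<nu> \<alpha>" if "\<alpha> \<in> carrier \<Omega>" for \<alpha>
        using cl[OF \<open>\<nu> \<in> central_maps\<close> that] cl[OF \<mu>(1) that]
        by (simp add: \<mu>'_def P1.M.a_assoc P1.M.l_neg)
      then show ?thesis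
        unfolding differential_cochain_def
        by (intro restrict_ext) (auto simp: tup differential_def)
    qed
    have "?class C = differential_cochain ` central_maps"
    proof (intro equalityI subsetI)
      fix h assume "h \<in> ?class C"
      then obtain \<nu> where \<nu>: "\<nu> \<in> central_maps" "h = ?add (differential_cochain \<nu>) C"
        unfolding class_eq by blast
      then have "h = differential_cochain (\<lambda>\<alpha>. \<nu> \<alpha> \<oplus>\<^bsub>P\<^sub>1\<^esub> \<mu> \<alpha>)"
        unfolding \<mu>(2) using add_diff \<mu>(1) by blast
      with differential_add(1)[OF \<nu>(1) \<mu>(1)] show "h \<in> differential_cochain ` central_maps" by blast
    next
      fix h assume "h \<in> differential_cochain ` central_maps"
      then obtain \<nu> where \<nu>: "\<nu> \<in> central_maps" "h = differential_cochain \<nu>" by blast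
      note sum = differential_add(1)[OF \<nu>(1) \<mu>']
      have "h = ?add (differential_cochain (\<lambda>\<alpha>. \<nu> \<alpha> \<oplus>\<^bsub>P\<^sub>1\<^esub> \<mu>' \<alpha>)) C"
        unfolding \<mu>(2) add_diff[OF sum \<mu>(1)] shift[OF \<nu>(1)] by (rule \<nu>(2))
      with sum show "h \<in> ?class C" unfolding class_eq by blast
    qed
    also have "\<dots> = ?class ?zero"
      unfolding class_eq Setcompr_eq_image by (rule image_cong[OF refl, symmetric]) (rule add_zero)
    finally show "?class C = ?class ?zero" .
  qed
qed

section \<open>The family of deformed brackets\<close>

lemma deformed_bracket_eq_perturbed:
  "deformed_bracket R P\<^sub>0 P\<^sub>1 br\<^sub>1 br C t =
    perturbed_bracket (\<lambda>\<alpha> \<beta>. (t \<odot>\<^bsub>restrict_scalars P\<^sub>0 (cochain_module P\<^sub>0 \<Omega> P\<^sub>1 br\<^sub>1 2)\<^esub> C) [\<alpha>, \<beta>])"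
  by (auto simp: deformed_bracket_def perturbed_bracket_def Let_def fun_eq_iff)

lemma scaled_cochain_apply:
  "\<alpha> \<in> carrier \<Omega> \<Longrightarrow> \<beta> \<in> carrier \<Omega> \<Longrightarrow>
    (t \<odot>\<^bsub>restrict_scalars P\<^sub>0 (cochain_module P\<^sub>0 \<Omega> P\<^sub>1 br\<^sub>1 2)\<^esub> C) [\<alpha>, \<beta>] = (t \<odot>\<^bsub>P\<^sub>0\<^esub> \<one>\<^bsub>P\<^sub>0\<^esub>) \<odot>\<^bsub>P\<^sub>1\<^esub> C [\<alpha>, \<beta>]"
  by (simp add: cochain_module_def tuples_def)

lemma scaled_cochain_bilinear:
  assumes C: "C \<in> cochains P\<^sub>0 \<Omega> P\<^sub>1 br\<^sub>1 2" and t: "t \<in> carrier R"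
  defines "c \<equiv> \<lambda>\<alpha> \<beta>. (t \<odot>\<^bsub>restrict_scalars P\<^sub>0 (cochain_module P\<^sub>0 \<Omega> P\<^sub>1 br\<^sub>1 2)\<^esub> C) [\<alpha>, \<beta>]"
  shows "c \<in> bilinear_maps P\<^sub>0 \<Omega> \<Omega> P\<^sub>1" and "skew_symmetric_on (carrier \<Omega>) P\<^sub>1 c"
proof -
  note bil = cochains_2_bilinear[OF Om.module_axioms module_P1 C]
  have c: "c \<alpha> \<beta> = (t \<odot>\<^bsub>P\<^sub>0\<^esub> \<one>\<^bsub>P\<^sub>0\<^esub>) \<odot>\<^bsub>P\<^sub>1\<^esub> C [\<alpha>, \<beta>]" if "\<alpha> \<in> carrier \<Omega>" "\<beta> \<in> carrier \<Omega>" for \<alpha> \<beta>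
    unfolding c_def using that by (rule scaled_cochain_apply)
  show skew: "skew_symmetric_on (carrier \<Omega>) P\<^sub>1 c"
    unfolding skew_symmetric_on_def
  proof (intro ballI)
    fix \<alpha> \<beta> assume *: "\<alpha> \<in> carrier \<Omega>" "\<beta> \<in> carrier \<Omega>"
    then have "C [\<alpha>, \<beta>] = \<ominus>\<^bsub>P\<^sub>1\<^esub> C [\<beta>, \<alpha>]"
      using bil(2) unfolding skew_symmetric_on_def by blast
    then show "c \<alpha> \<beta> = \<ominus>\<^bsub>P\<^sub>1\<^esub> c \<beta> \<alpha>"
      using * t center_closed[OF bil(3)] by (simp add: c P1.smult_r_minus)
  qed
  show "c \<in> bilinear_maps P\<^sub>0 \<Omega> \<Omega> P\<^sub>1"
  proof (rule bilinear_mapsI_skew[OF Om.module_axioms module_P1 _ skew])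
    fix \<alpha> assume \<alpha>: "\<alpha> \<in> carrier \<Omega>"
    then have "(\<lambda>\<beta>. C [\<alpha>, \<beta>]) \<in> linear_maps P\<^sub>0 \<Omega> P\<^sub>1"
      using bil(1) by (simp add: bilinear_maps_def)
    from linear_maps_pointwise_smult[OF module_P1 scalar_closed[OF t] this]
    show "c \<alpha> \<in> linear_maps P\<^sub>0 \<Omega> P\<^sub>1"
      by (rule linear_maps_cong[OF _ Om.module_axioms]) (simp add: c \<alpha>)
  qed
qed

text \<open>The cocycle identity of \<open>C\<close> is multiplied by the image of \<open>t\<close>
  in \<open>P\<^sub>0\<close>, which moves inside \<open>D\<close> by \<open>R\<close>-linearity and
  yields the identity for \<open>t C\<close>.\<close>

lemma admissible_deformed_bracket:
  assumes C: "C \<in> cocycles P\<^sub>0 \<Omega> lb P\<^sub>1 br\<^sub>1 D 2" and t: "t \<in> carrier R"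
  shows "admissible_poisson R P\<^sub>0 br\<^sub>0 P\<^sub>1 (deformed_bracket R P\<^sub>0 P\<^sub>1 br\<^sub>1 br C t)"
proof -
  have C2: "C \<in> cochains P\<^sub>0 \<Omega> P\<^sub>1 br\<^sub>1 2" using C by (simp add: cocycles_def)
  note CZ = cochains_2_bilinear(3)[OF Om.module_axioms module_P1 C2]
  note [simp] = center_closed[OF CZ]
  let ?s = "t \<odot>\<^bsub>P\<^sub>0\<^esub> \<one>\<^bsub>P\<^sub>0\<^esub>"
  show ?thesis
    unfolding deformed_bracket_eq_perturbed
  proof (rule admissible_perturbed_bracket[OF scaled_cochain_bilinear[OF C2 t]])
    fix \<alpha> \<beta> \<gamma> assume abc: "\<alpha> \<in> carrier \<Omega>" "\<beta> \<in> carrier \<Omega>" "\<gamma> \<in> carrier \<Omega>"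
    have "?s \<odot>\<^bsub>P\<^sub>1\<^esub> ((D \<alpha> (C [\<beta>, \<gamma>]) \<oplus>\<^bsub>P\<^sub>1\<^esub> C [\<alpha>, lb \<beta> \<gamma>]) \<oplus>\<^bsub>P\<^sub>1\<^esub>
      (D \<beta> (C [\<gamma>, \<alpha>]) \<oplus>\<^bsub>P\<^sub>1\<^esub> C [\<beta>, lb \<gamma> \<alpha>]) \<oplus>\<^bsub>P\<^sub>1\<^esub> (D \<gamma> (C [\<alpha>, \<beta>]) \<oplus>\<^bsub>P\<^sub>1\<^esub> C [\<gamma>, lb \<alpha> \<beta>])) = \<zero>\<^bsub>P\<^sub>1\<^esub>"
      using cocycle_identity[OF C abc] t by simp
    then show "(D \<alpha> ((t \<odot>\<^bsub>restrict_scalars P\<^sub>0 (cochain_module P\<^sub>0 \<Omega> P\<^sub>1 br\<^sub>1 2)\<^esub> C) [\<beta>, \<gamma>]) \<oplus>\<^bsub>P\<^sub>1\<^esub>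
        (t \<odot>\<^bsub>restrict_scalars P\<^sub>0 (cochain_module P\<^sub>0 \<Omega> P\<^sub>1 br\<^sub>1 2)\<^esub> C) [\<alpha>, lb \<beta> \<gamma>]) \<oplus>\<^bsub>P\<^sub>1\<^esub>
      (D \<beta> ((t \<odot>\<^bsub>restrict_scalars P\<^sub>0 (cochain_module P\<^sub>0 \<Omega> P\<^sub>1 br\<^sub>1 2)\<^esub> C) [\<gamma>, \<alpha>]) \<oplus>\<^bsub>P\<^sub>1\<^esub>
        (t \<odot>\<^bsub>restrict_scalars P\<^sub>0 (cochain_module P\<^sub>0 \<Omega> P\<^sub>1 br\<^sub>1 2)\<^esub> C) [\<beta>, lb \<gamma> \<alpha>]) \<oplus>\<^bsub>P\<^sub>1\<^esub>
      (D \<gamma> ((t \<odot>\<^bsub>restrict_scalars P\<^sub>0 (cochain_module P\<^sub>0 \<Omega> P\<^sub>1 br\<^sub>1 2)\<^esub> C) [\<alpha>, \<beta>]) \<oplus>\<^bsub>P\<^sub>1\<^esub>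
        (t \<odot>\<^bsub>restrict_scalars P\<^sub>0 (cochain_module P\<^sub>0 \<Omega> P\<^sub>1 br\<^sub>1 2)\<^esub> C) [\<gamma>, lb \<alpha> \<beta>]) = \<zero>\<^bsub>P\<^sub>1\<^esub>"
      using abc t by (simp add: scaled_cochain_apply D_scalar P1.smult_r_distr del: restrict_scalars_simps)
  qed (simp add: scaled_cochain_apply CZ t del: restrict_scalars_simps)
qed

text \<open>The added term is the zero of \<open>P\<close>. Adding it is known to give back
  \<open>br x y\<close> when that value lies in the carrier, hence the restriction on
  \<open>x\<close> and \<open>y\<close>.\<close>

lemma deformed_bracket_zero:
  assumes C: "C \<in> cochains P\<^sub>0 \<Omega> P\<^sub>1 br\<^sub>1 2" and xy: "x \<in> carrier P" "y \<in> carrier P"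
  shows "deformed_bracket R P\<^sub>0 P\<^sub>1 br\<^sub>1 br C \<zero>\<^bsub>R\<^esub> x y = br x y"
proof -
  have "C [d (fst x), d (fst y)] \<in> carrier P\<^sub>1"
    using xy by (intro center_closed[OF cochains_2_bilinear(3)[OF Om.module_axioms module_P1 C]]) auto
  then have "deformed_bracket R P\<^sub>0 P\<^sub>1 br\<^sub>1 br C \<zero>\<^bsub>R\<^esub> x y = br x y \<oplus>\<^bsub>P\<^esub> \<zero>\<^bsub>P\<^esub>"
    unfolding deformed_bracket_eq_perturbed perturbed_bracket_def
    using xy by (auto simp: scaled_cochain_apply simp del: restrict_scalars_simps)
  then show ?thesis
    by (simp only: P.M.r_zero[OF br_closed[OF xy]])
qed

text \<open>The family is an arbitrary function of \<open>t\<close>, so each parameter value can be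
  tested separately, and each test says that the map at \<open>t\<close> is central with
  differential \<open>t C\<close>.\<close>

lemma gauge_trivial_iff:
  assumes C: "C \<in> cochains P\<^sub>0 \<Omega> P\<^sub>1 br\<^sub>1 2"
  shows "(\<exists>\<mu>. \<forall>t\<in>carrier R. \<mu> t \<in> linear_maps P\<^sub>0 \<Omega> P\<^sub>1 \<and>
      poisson_iso R P (deformed_bracket R P\<^sub>0 P\<^sub>1 br\<^sub>1 br C t) P br (gauge R P\<^sub>0 P\<^sub>1 (\<mu> t))) \<longleftrightarrow>
    (\<exists>\<mu>\<in>central_maps. \<forall>\<alpha>\<in>carrier \<Omega>. \<forall>\<beta>\<in>carrier \<Omega>. C [\<alpha>, \<beta>] = differential \<mu> \<alpha> \<beta>)"
    (is "(\<exists>\<mu>. \<forall>t\<in>carrier R. _ \<and> ?iso t (\<mu> t)) \<longleftrightarrow> ?exact")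
proof -
  have iso_iff: "?iso t \<mu> \<longleftrightarrow> (\<forall>\<alpha>\<in>carrier \<Omega>. \<mu> \<alpha> \<in> Z) \<and>
      (\<forall>\<alpha>\<in>carrier \<Omega>. \<forall>\<beta>\<in>carrier \<Omega>. (t \<odot>\<^bsub>P\<^sub>0\<^esub> \<one>\<^bsub>P\<^sub>0\<^esub>) \<odot>\<^bsub>P\<^sub>1\<^esub> C [\<alpha>, \<beta>] = differential \<mu> \<alpha> \<beta>)"
    if "t \<in> carrier R" "\<mu> \<in> linear_maps P\<^sub>0 \<Omega> P\<^sub>1" for t \<mu>
    unfolding deformed_bracket_eq_perturbed
      gauge_poisson_iso_iff[OF that(2) scaled_cochain_bilinear(1)[OF C that(1)]]
    \<comment> \<open>The congruence rule provides membership in \<Omega>, under which the scaled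
      cochain may be evaluated.\<close>
    by (simp add: scaled_cochain_apply cong: ball_cong del: restrict_scalars_simps)
  show ?thesis
  proof
    assume "\<exists>\<mu>. \<forall>t\<in>carrier R. \<mu> t \<in> linear_maps P\<^sub>0 \<Omega> P\<^sub>1 \<and> ?iso t (\<mu> t)"
    then obtain \<mu> where \<mu>: "\<mu> \<in> linear_maps P\<^sub>0 \<Omega> P\<^sub>1" "?iso \<one>\<^bsub>R\<^esub> \<mu>"
      using P0.R.one_closed by blast
    have "C [\<alpha>, \<beta>] \<in> carrier P\<^sub>1" if "\<alpha> \<in> carrier \<Omega>" "\<beta> \<in> carrier \<Omega>" for \<alpha> \<beta>
      using cochains_2_bilinear(3)[OF Om.module_axioms module_P1 C that] by (rule center_closed)
    with \<mu>(2) show ?exact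
      unfolding iso_iff[OF P0.R.one_closed \<mu>(1)] using \<mu>(1) by (intro bexI[of _ \<mu>]) auto
  next
    assume ?exact
    then obtain \<mu> where \<mu>: "\<mu> \<in> central_maps"
      and eq: "\<And>\<alpha> \<beta>. \<alpha> \<in> carrier \<Omega> \<Longrightarrow> \<beta> \<in> carrier \<Omega> \<Longrightarrow> C [\<alpha>, \<beta>] = differential \<mu> \<alpha> \<beta>"
      by blast
    let ?\<mu> = "\<lambda>t \<alpha>. (t \<odot>\<^bsub>P\<^sub>0\<^esub> \<one>\<^bsub>P\<^sub>0\<^esub>) \<odot>\<^bsub>P\<^sub>1\<^esub> \<mu> \<alpha>"
    have "?\<mu> t \<in> linear_maps P\<^sub>0 \<Omega> P\<^sub>1 \<and> ?iso t (?\<mu> t)" if t: "t \<in> carrier R" for t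
    proof -
      have lin: "?\<mu> t \<in> linear_maps P\<^sub>0 \<Omega> P\<^sub>1" and cent: "\<And>\<alpha>. \<alpha> \<in> carrier \<Omega> \<Longrightarrow> ?\<mu> t \<alpha> \<in> Z"
        using differential_scalar(1)[OF \<mu> t] by blast+
      then show ?thesis
        unfolding iso_iff[OF t lin] by (simp add: eq differential_scalar(2)[OF \<mu> t])
    qed
    then show "\<exists>\<mu>. \<forall>t\<in>carrier R. \<mu> t \<in> linear_maps P\<^sub>0 \<Omega> P\<^sub>1 \<and> ?iso t (\<mu> t)"
      by (intro exI[of _ ?\<mu>]) blast
  qed
qed

end

theorem theorem6p13:
  fixes R :: "('r, 'rx) ring_scheme"
    and P\<^sub>0 :: "('r, 'a, 'ax) module_scheme"
    and P\<^sub>1 :: "('a, 'm, 'mx) module_scheme"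
    and br\<^sub>0 :: "'a \<Rightarrow> 'a \<Rightarrow> 'a"
    and br :: "'a \<times> 'm \<Rightarrow> 'a \<times> 'm \<Rightarrow> 'a \<times> 'm"
    and C :: "('a \<Rightarrow> 'a) set list \<Rightarrow> 'm"
  defines "\<Omega> \<equiv> kahler R P\<^sub>0"
    and "P \<equiv> semidirect P\<^sub>0 P\<^sub>1"
  assumes "cring R"
    and "poisson_algebra R P\<^sub>0 br\<^sub>0"
    and "faithful_module P\<^sub>0 P\<^sub>1"
    and "poisson_anchor R P\<^sub>0 br\<^sub>0 \<rho>"
    and "kahler_lie_bracket R P\<^sub>0 br\<^sub>0 \<rho> lb"
    and "admissible_poisson R P\<^sub>0 br\<^sub>0 P\<^sub>1 br"
    and "corresponding_triple R P\<^sub>0 br\<^sub>0 \<rho> P\<^sub>1 br br\<^sub>1 D \<K>"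
    and "C \<in> cocycles P\<^sub>0 \<Omega> lb P\<^sub>1 br\<^sub>1 D 2"
  shows "(\<forall>t\<in>carrier R. admissible_poisson R P\<^sub>0 br\<^sub>0 P\<^sub>1 (deformed_bracket R P\<^sub>0 P\<^sub>1 br\<^sub>1 br C t)) \<and>
    (\<forall>x\<in>carrier P. \<forall>y\<in>carrier P. deformed_bracket R P\<^sub>0 P\<^sub>1 br\<^sub>1 br C \<zero>\<^bsub>R\<^esub> x y = br x y) \<and>
    ((\<exists>\<mu>. \<forall>t\<in>carrier R. \<mu> t \<in> linear_maps P\<^sub>0 \<Omega> P\<^sub>1 \<and>
        poisson_iso R P (deformed_bracket R P\<^sub>0 P\<^sub>1 br\<^sub>1 br C t) P br (gauge R P\<^sub>0 P\<^sub>1 (\<mu> t)))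
     \<longleftrightarrow>
     cohomology_class P\<^sub>0 \<Omega> lb P\<^sub>1 br\<^sub>1 D 2 C =
       cohomology_class P\<^sub>0 \<Omega> lb P\<^sub>1 br\<^sub>1 D 2 \<zero>\<^bsub>cochain_module P\<^sub>0 \<Omega> P\<^sub>1 br\<^sub>1 2\<^esub>)"
proof -
  interpret T: admissible_poisson_triple R P\<^sub>0 P\<^sub>1 br\<^sub>0 \<rho> lb br br\<^sub>1 D \<K>
    using assms by (simp add: admissible_poisson_triple_def faithful_module_def)
  have C: "C \<in> cochains P\<^sub>0 (kahler R P\<^sub>0) P\<^sub>1 br\<^sub>1 2"
    using assms(10) by (simp add: cocycles_def \<Omega>_def)
  show ?thesis
    unfolding \<Omega>_def P_def T.gauge_trivial_iff[OF C] T.cohomology_class_trivial_iff[OF C]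
    using T.admissible_deformed_bracket[OF assms(10)[unfolded \<Omega>_def]] T.deformed_bracket_zero[OF C]
    by blast
qed

end
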